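(* Let $\alpha>-1$ and let $\{a_k\}_k\subset\mathbb B^n$ be a separated sequence. If there exists $m>0$ such that $K(\{a_k\},m,n+1+\alpha)<1$, then $\{a_k\}$ is an interpolating sequence for $B^1_\alpha$.
   Context: $\mathbb B^n$ is the unit ball of $\mathbb C^n$, $z\bar w=\sum_j z_j\bar w_j$; $d(a,b)=|\varphi_a(b)|$ is the invariant distance, with $1-d(a,b)^2=\frac{(1-|a|^2)(1-|b|^2)}{|1-a\bar b|^2}$; a sequence is separated if there is $\delta>0$ with $d(a_j,a_k)\ge\delta$ for $j\ne k$. For $p,q>0$, $K(\{a_k\},p,q)=\sup_k\sum_{j\ne k}\frac{(1-|a_k|^2)^p(1-|a_j|^2)^q}{|1-\bar a_k a_j|^{p+q}}$. $B^1_\alpha$ is the space of holomorphic $f$ on $\mathbb B^n$ with $\|f\|_{1,\alpha}=\int_{\mathbb B^n}(1-|z|^2)^\alpha|f|\,dm<\infty$. A sequence is interpolating for $B^1_\alpha$ if for every complex sequence $v$ with $\sum_k(1-|a_k|^2)^{n+1+\alpha}|v_k|<\infty$ there is $f\in B^1_\alpha$ with $f(a_k)=v_k$ for all $k$. *)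

theory Defs
  imports "HOL-Analysis.Analysis"
begin

definition herm :: "complex^'n \<Rightarrow> complex^'n \<Rightarrow> complex" where
  "herm z w = (\<Sum>j\<in>UNIV. z$j * cnj (w$j))"

definition unit_ball :: "(complex^'n) set" where
  "unit_ball = ball 0 1"

text \<open>Invariant (pseudo-hyperbolic) distance, via
  1 - d(a,b)^2 = (1-|a|^2)(1-|b|^2)/|1 - a conj(b)|^2.\<close>
definition inv_dist :: "complex^'n \<Rightarrow> complex^'n \<Rightarrow> real" where
  "inv_dist a b = sqrt (1 - (1 - (norm a)\<^sup>2) * (1 - (norm b)\<^sup>2) / (cmod (1 - herm a b))\<^sup>2)"

definition separated :: "(nat \<Rightarrow> complex^'n) \<Rightarrow> bool" where
  "separated a \<longleftrightarrow> (\<exists>\<delta>>0. \<forall>j k. j \<noteq> k \<longrightarrow> inv_dist (a j) (a k) \<ge> \<delta>)"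

definition Kconst :: "(nat \<Rightarrow> complex^'n) \<Rightarrow> real \<Rightarrow> real \<Rightarrow> ennreal" where
  "Kconst a p q = (SUP k. \<Sum>j. (if j = k then 0 else
      ennreal ((1 - (norm (a k))\<^sup>2) powr p * (1 - (norm (a j))\<^sup>2) powr q
               / (cmod (1 - herm (a j) (a k))) powr (p + q))))"

definition holo_on :: "(complex^'n \<Rightarrow> complex) \<Rightarrow> (complex^'n) set \<Rightarrow> bool" where
  "holo_on f S \<longleftrightarrow> (\<forall>z\<in>S. \<exists>D. (f has_derivative D) (at z) \<and> (\<forall>c w. D (c *s w) = c * D w))"

definition bergman1 :: "real \<Rightarrow> (complex^'n \<Rightarrow> complex) set" where
  "bergman1 \<alpha> = {f. holo_on f unit_ball \<and>
     (\<integral>\<^sup>+ z. ennreal (indicator unit_ball z * (1 - (norm z)\<^sup>2) powr \<alpha> * cmod (f z)) \<partial>lborel) < \<infinity>}"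

definition interpolating_B1 :: "real \<Rightarrow> (nat \<Rightarrow> complex^'n) \<Rightarrow> bool" where
  "interpolating_B1 \<alpha> a \<longleftrightarrow>
     (\<forall>v :: nat \<Rightarrow> complex.
        summable (\<lambda>k. (1 - (norm (a k))\<^sup>2) powr (real CARD('n) + 1 + \<alpha>) * cmod (v k)) \<longrightarrow>
        (\<exists>f\<in>bergman1 \<alpha>. \<forall>k. f (a k) = v k))"

end

theory Submission
  imports Defs
begin

text \<open>
  Put \<open>N = n + 1 + \<alpha>\<close>, \<open>s = m + N\<close> and \<open>k\<^sub>j(z) = ((1 - |a\<^sub>j|\<^sup>2) / (1 - z \<cdot> a\<^sub>j))\<^sup>s\<close>, so that
  \<open>k\<^sub>j(a\<^sub>j) = 1\<close>. On the sequences with \<open>\<Sum> (1 - |a\<^sub>k|\<^sup>2)\<^sup>N |w\<^sub>k| < \<infinity>\<close> the matrix with entries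
  \<open>k\<^sub>j(a\<^sub>k)\<close>, \<open>j \<noteq> k\<close>, has operator norm at most \<open>K({a\<^sub>k}, m, N) < 1\<close>. A Neumann series thus
  yields \<open>w\<close> in this space such that \<open>f = \<Sum> w\<^sub>j k\<^sub>j\<close> takes the prescribed values.

  That \<open>f\<close> has finite norm follows from the Forelli-Rudin estimate
  \<open>\<integral> (1 - |z|\<^sup>2)\<^sup>\<alpha> |1 - z \<cdot> a|\<^sup>-\<^sup>s \<le> C (1 - |a|\<^sup>2)\<^sup>-\<^sup>m\<close>, a dyadic sum over \<open>t\<close> of the bound
  \<open>C t\<^sup>N\<close> for the integral of \<open>(1 - |z|\<^sup>2)\<^sup>\<alpha>\<close> over \<open>{|1 - z \<cdot> a| < t}\<close>. On this region
  \<open>1 - |z|\<^sup>2 \<le> 2 t\<close> and \<open>|z - a|\<^sup>2 \<le> 2 t\<close>. No rotation of \<open>a\<close> is needed: choose a real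
  coordinate in which \<open>a\<close> is largest and integrate it first, which gives \<open>t\<^sup>\<alpha>\<^sup>+\<^sup>1\<close>. The other real
  coordinate of the same complex coordinate ranges over an interval of length of order \<open>t\<close>, and each
  of the remaining \<open>2 n - 2\<close> real coordinates over one of length of order \<open>\<surd>t\<close>.
\<close>

section \<open>Slicing the weight\<close>

lemma nn_integral_powr_Ioc:
  fixes \<alpha> T :: real
  assumes "\<alpha> > -1" "T \<ge> 0"
  shows "(\<integral>\<^sup>+ x. ennreal (indicator {0<..T} x * x powr \<alpha>) \<partial>lborel) = ennreal (T powr (\<alpha> + 1) / (\<alpha> + 1))"
proof (rule nn_integral_has_integral_lborel)
  have "((\<lambda>x. x powr \<alpha>) has_integral (T powr (\<alpha>+1) / (\<alpha>+1))) {0..T}"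
    using has_integral_powr_from_0[OF assms] .
  then have "((\<lambda>x. if x \<in> {0..T} then x powr \<alpha> else 0) has_integral (T powr (\<alpha>+1) / (\<alpha>+1))) UNIV"
    by (simp only: has_integral_restrict_UNIV)
  moreover have "(\<lambda>x. if x \<in> {0..T} then x powr \<alpha> else 0) = (\<lambda>x. indicator {0<..T} x * x powr \<alpha>)"
    by (auto simp: fun_eq_iff indicator_def)
  ultimately show "((\<lambda>x. indicator {0<..T} x * x powr \<alpha>) has_integral (T powr (\<alpha>+1) / (\<alpha>+1))) UNIV"
    by simp
qed auto

text \<open>With \<open>s = sqrt S\<close>, factor \<open>S - x^2 = (s + |x|) * (s - |x|)\<close>.
  The first factor lies in \<open>[c, 2]\<close>, so its power is bounded; the second lies in
  \<open>(0, \<tau>/c]\<close>, which leaves the integral of \<open>r powr \<alpha>\<close> there.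
  The factor 2 counts the two signs of \<open>x\<close>.\<close>

lemma nn_integral_slice_le:
  fixes \<alpha> c \<tau> S :: real
  assumes \<alpha>: "\<alpha> > -1" and c: "c > 0" and \<tau>: "\<tau> \<ge> 0" and S: "S \<le> 1"
  shows "(\<integral>\<^sup>+ x. ennreal (indicator {x. c \<le> \<bar>x\<bar> \<and> 0 < S - x\<^sup>2 \<and> S - x\<^sup>2 \<le> \<tau>} x * (S - x\<^sup>2) powr \<alpha>) \<partial>lborel)
    \<le> ennreal (2 * (c powr \<alpha> + 2 powr \<alpha>) / c powr (\<alpha> + 1) / (\<alpha> + 1) * \<tau> powr (\<alpha> + 1))"
proof -
  define s where "s = sqrt S"
  \<comment> \<open>A sum instead of a maximum: it dominates \<open>p powr \<alpha>\<close> on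
    \<open>[c, 2]\<close> whether the power increases or decreases.\<close>
  define M where "M = c powr \<alpha> + 2 powr \<alpha>"
  define \<phi> :: "real \<Rightarrow> real" where "\<phi> = (\<lambda>r. indicator {0<..\<tau>/c} r * r powr \<alpha>)"
  have \<phi>_meas [measurable]: "\<phi> \<in> borel_measurable borel" by (simp add: \<phi>_def)
  have \<phi>0: "\<phi> r \<ge> 0" for r by (simp add: \<phi>_def)
  have M0: "M \<ge> 0" by (simp add: M_def)
  have pw: "indicator {x. c \<le> \<bar>x\<bar> \<and> 0 < S - x\<^sup>2 \<and> S - x\<^sup>2 \<le> \<tau>} x * (S - x\<^sup>2) powr \<alpha>
      \<le> M * \<phi> (s - x) + M * \<phi> (s + x)" for x
  proof (cases "c \<le> \<bar>x\<bar> \<and> 0 < S - x\<^sup>2 \<and> S - x\<^sup>2 \<le> \<tau>")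
    case True
    have "S > 0" using True zero_le_power2[of x] by linarith
    then have s: "s > 0" "s\<^sup>2 = S" "s \<le> 1" using S by (auto simp: s_def)
    have xs: "\<bar>x\<bar> < s"
    proof (rule power2_less_imp_less)
      show "\<bar>x\<bar>\<^sup>2 < s\<^sup>2" unfolding s(2) power2_abs using True by linarith
    qed (use s in linarith)
    define p where "p = s + \<bar>x\<bar>" define r where "r = s - \<bar>x\<bar>"
    have p: "c \<le> p" "p \<le> 2" "p > 0" using True s xs c by (auto simp: p_def)
    have r: "r > 0" using xs by (simp add: r_def)
    have fac: "S - x\<^sup>2 = p * r"
      unfolding s(2)[symmetric] p_def r_def by (simp add: power2_eq_square algebra_simps)
    have "c * r \<le> p * r" using p r by simp
    then have r2: "r \<le> \<tau>/c" using True fac c by (simp add: field_simps)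
    have pM: "p powr \<alpha> \<le> M"
    proof (cases "\<alpha> \<ge> 0")
      case True
      then have "p powr \<alpha> \<le> 2 powr \<alpha>" using p by (intro powr_mono2) auto
      then show ?thesis by (simp add: M_def add_increasing)
    next
      case False
      then have "p powr \<alpha> \<le> c powr \<alpha>" using p c by (intro powr_mono2') auto
      then show ?thesis by (simp add: M_def add_increasing2)
    qed
    have "(S - x\<^sup>2) powr \<alpha> = p powr \<alpha> * r powr \<alpha>" using fac p r by (simp add: powr_mult)
    also have "\<dots> \<le> M * \<phi> r" using pM r r2 by (auto simp: \<phi>_def intro!: mult_right_mono)
    \<comment> \<open>One of \<open>s - x\<close> and \<open>s + x\<close> equals \<open>r\<close>;
      the other term is nonnegative.\<close>
    also have "\<dots> \<le> M * \<phi> (s - x) + M * \<phi> (s + x)"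
      using M0 \<phi>0 by (cases "x \<ge> 0") (auto simp: r_def)
    finally show ?thesis using True by simp
  qed (use M0 \<phi>0 in auto)
  have "(\<integral>\<^sup>+ x. ennreal (indicator {x. c \<le> \<bar>x\<bar> \<and> 0 < S - x\<^sup>2 \<and> S - x\<^sup>2 \<le> \<tau>} x * (S - x\<^sup>2) powr \<alpha>) \<partial>lborel)
     \<le> (\<integral>\<^sup>+ x. ennreal M * ennreal (\<phi> (s - x)) + ennreal M * ennreal (\<phi> (s + x)) \<partial>lborel)"
    using pw M0 \<phi>0 by (intro nn_integral_mono) (simp flip: ennreal_plus ennreal_mult)
  also have "\<dots> = ennreal M * (\<integral>\<^sup>+ x. ennreal (\<phi> (s - x)) \<partial>lborel) + ennreal M * (\<integral>\<^sup>+ x. ennreal (\<phi> (s + x)) \<partial>lborel)"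
    by (subst nn_integral_add) (auto simp: nn_integral_cmult)
  also have "(\<integral>\<^sup>+ x. ennreal (\<phi> (s - x)) \<partial>lborel) = (\<integral>\<^sup>+ x. ennreal (\<phi> x) \<partial>lborel)"
    using nn_integral_real_affine[of "\<lambda>x. ennreal (\<phi> x)" "-1" s] by simp
  also have "(\<integral>\<^sup>+ x. ennreal (\<phi> (s + x)) \<partial>lborel) = (\<integral>\<^sup>+ x. ennreal (\<phi> x) \<partial>lborel)"
    using nn_integral_real_affine[of "\<lambda>x. ennreal (\<phi> x)" 1 s] by simp
  also have "(\<integral>\<^sup>+ x. ennreal (\<phi> x) \<partial>lborel) = ennreal ((\<tau>/c) powr (\<alpha> + 1) / (\<alpha> + 1))"
    unfolding \<phi>_def using \<alpha> \<tau> c by (intro nn_integral_powr_Ioc) auto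
  also have "ennreal M * ennreal ((\<tau>/c) powr (\<alpha> + 1) / (\<alpha> + 1)) + ennreal M * ennreal ((\<tau>/c) powr (\<alpha> + 1) / (\<alpha> + 1))
     = ennreal (2 * M / c powr (\<alpha> + 1) / (\<alpha> + 1) * \<tau> powr (\<alpha> + 1))"
    using M0 \<alpha> c \<tau> by (simp add: powr_divide mult_ac flip: ennreal_mult ennreal_plus)
  finally show ?thesis by (simp add: M_def)
qed

text \<open>Tonelli in coordinates: the slice bound handles \<open>b\<close>, and the other
  coordinates contribute only the lengths of their ranges. The range of \<open>b'\<close> may move
  with the remaining coordinates, so \<open>Eb'\<close> bounds its diameter on each fibre; the
  remaining coordinates lie in one fixed box around \<open>u\<close>.\<close>

lemma nn_integral_ball_weight_le:
  fixes \<alpha> c :: real and b b' u :: "'a::euclidean_space" and E :: "'a set"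
  assumes \<alpha>: "\<alpha> > -1" and c: "c > 0"
    and E [measurable]: "E \<in> sets borel"
    and b: "b \<in> Basis" "b' \<in> Basis" "b \<noteq> b'"
    and \<tau>: "\<tau> \<ge> 0" and l1: "l1 \<ge> 0" and l2: "l2 \<ge> 0"
    and Eb: "\<And>z. z \<in> E \<Longrightarrow> norm z < 1 \<and> c \<le> \<bar>z \<bullet> b\<bar> \<and> 1 - (norm z)\<^sup>2 \<le> \<tau>"
    and Eb': "\<And>z w. z \<in> E \<Longrightarrow> w \<in> E \<Longrightarrow> (\<And>e. e \<in> Basis - {b, b'} \<Longrightarrow> z \<bullet> e = w \<bullet> e) \<Longrightarrow> \<bar>z \<bullet> b' - w \<bullet> b'\<bar> \<le> l1"
    and Ee: "\<And>z e. z \<in> E \<Longrightarrow> e \<in> Basis - {b, b'} \<Longrightarrow> \<bar>z \<bullet> e - u \<bullet> e\<bar> \<le> l2"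
  shows "(\<integral>\<^sup>+ z. ennreal (indicator E z * (1 - (norm z)\<^sup>2) powr \<alpha>) \<partial>lborel)
    \<le> ennreal (2 * (c powr \<alpha> + 2 powr \<alpha>) / c powr (\<alpha> + 1) / (\<alpha> + 1) * \<tau> powr (\<alpha> + 1)
        * (2 * l1) * (2 * l2) ^ (DIM('a) - 2))"
proof -
  define C where "C = 2 * (c powr \<alpha> + 2 powr \<alpha>) / c powr (\<alpha> + 1) / (\<alpha> + 1) * \<tau> powr (\<alpha> + 1)"
  have C0: "C \<ge> 0" using \<alpha> by (simp add: C_def)
  define B where "B = Basis - {b, b'}"
  have B: "finite B" "b' \<notin> B" "b \<notin> insert b' B" "Basis = insert b (insert b' B)"
    using b by (auto simp: B_def)
  have cardB: "card B = DIM('a) - 2" using b by (simp add: B_def card_Diff_subset)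
  \<comment> \<open>Assembles a vector from its coordinates; Lebesgue measure is the image of the
    product measure under this map.\<close>
  define V :: "('a \<Rightarrow> real) \<Rightarrow> 'a" where "V = (\<lambda>f. \<Sum>e\<in>Basis. f e *\<^sub>R e)"
  have V_meas [measurable]: "V \<in> measurable (\<Pi>\<^sub>M e\<in>Basis. lborel) borel"
    unfolding V_def by measurable
  have Ve: "V f \<bullet> e = f e" if "e \<in> Basis" for f e
    using that by (simp add: V_def)
  define h :: "'a \<Rightarrow> ennreal" where "h = (\<lambda>z. ennreal (indicator E z * (1 - (norm z)\<^sup>2) powr \<alpha>))"
  have h_meas [measurable]: "h \<in> borel_measurable borel" unfolding h_def by measurable
  interpret product_sigma_finite "\<lambda>_::'a. lborel :: real measure" by standard
  have hV_meas: "(\<lambda>f. h (V f)) \<in> borel_measurable (Pi\<^sub>M (insert b (insert b' B)) (\<lambda>_. lborel))"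
    using V_meas h_meas unfolding B(4) by measurable
  have inner: "(\<integral>\<^sup>+ x. h (V (f(b := x))) \<partial>lborel) \<le> ennreal C" for f
  proof -
    \<comment> \<open>Once all coordinates except \<open>b\<close> are fixed, the weight has the
      form \<open>(S - x^2) powr \<alpha>\<close> of the slice bound.\<close>
    define S where "S = 1 - (\<Sum>e\<in>insert b' B. (f e)\<^sup>2)"
    have n: "1 - (norm (V (f(b := x))))\<^sup>2 = S - x\<^sup>2" for x
    proof -
      have "(norm (V (f(b := x))))\<^sup>2 = (\<Sum>e\<in>Basis. ((f(b := x)) e)\<^sup>2)"
        unfolding power2_norm_eq_inner by (subst euclidean_inner) (simp add: Ve power2_eq_square)
      also have "\<dots> = x\<^sup>2 + (\<Sum>e\<in>insert b' B. (f e)\<^sup>2)"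
        unfolding B(4) using B(1,3) by (subst sum.insert) (auto intro!: sum.cong)
      finally show ?thesis by (simp add: S_def)
    qed
    have "S \<le> 1" unfolding S_def by (simp add: sum_nonneg)
    have "(\<integral>\<^sup>+ x. h (V (f(b := x))) \<partial>lborel) \<le>
      (\<integral>\<^sup>+ x. ennreal (indicator {x. c \<le> \<bar>x\<bar> \<and> 0 < S - x\<^sup>2 \<and> S - x\<^sup>2 \<le> \<tau>} x * (S - x\<^sup>2) powr \<alpha>) \<partial>lborel)"
    proof (intro nn_integral_mono)
      fix x
      show "h (V (f(b := x))) \<le> ennreal (indicator {x. c \<le> \<bar>x\<bar> \<and> 0 < S - x\<^sup>2 \<and> S - x\<^sup>2 \<le> \<tau>} x * (S - x\<^sup>2) powr \<alpha>)"
      proof (cases "V (f(b := x)) \<in> E")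
        case True
        have "norm (V (f(b := x))) < 1" using Eb[OF True] by simp
        then have "(norm (V (f(b := x))))\<^sup>2 < 1" by (simp add: abs_square_less_1)
        then have "0 < S - x\<^sup>2" using n[of x] by simp
        moreover have "c \<le> \<bar>x\<bar>" "S - x\<^sup>2 \<le> \<tau>" using Eb[OF True] n[of x] b by (auto simp: Ve)
        ultimately show ?thesis by (simp add: h_def n)
      qed (simp add: h_def)
    qed
    also have "\<dots> \<le> ennreal C" unfolding C_def by (rule nn_integral_slice_le) fact+
    finally show ?thesis .
  qed
  \<comment> \<open>The indicator records that a nonempty fibre forces the remaining coordinates
    into the box. Membership in \<open>Pi\<^sub>E\<close> asks for extensionality besides the
    coordinate bounds.\<close>
  have middle: "(\<integral>\<^sup>+ y. \<integral>\<^sup>+ x. h (V (f(b' := y, b := x))) \<partial>lborel \<partial>lborel)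
      \<le> ennreal (C * (2 * l1)) * indicator (Pi\<^sub>E B (\<lambda>e. {u \<bullet> e - l2 .. u \<bullet> e + l2})) f" if f: "f \<in> extensional B" for f
  proof (cases "\<exists>y x. V (f(b' := y, b := x)) \<in> E")
    case False
    then have "h (V (f(b' := y, b := x))) = 0" for x y by (auto simp: h_def)
    then show ?thesis by simp
  next
    case True
    \<comment> \<open>Only the diameter of the \<open>b'\<close>-range is known, so the interval is
      centred at a point of the range, whence the length \<open>2 * l1\<close>.\<close>
    then obtain y0 x0 where 0: "V (f(b' := y0, b := x0)) \<in> E" by blast
    have box: "f \<in> Pi\<^sub>E B (\<lambda>e. {u \<bullet> e - l2 .. u \<bullet> e + l2})"
    proof (rule PiE_I)
      fix e assume e: "e \<in> B"
      then have "V (f(b' := y0, b := x0)) \<bullet> e = f e" using B(2,3) by (auto simp: B_def Ve)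
      then show "f e \<in> {u \<bullet> e - l2 .. u \<bullet> e + l2}" using Ee[OF 0, of e] e by (auto simp: B_def abs_le_iff)
    qed (use f in \<open>auto simp: extensional_def\<close>)
    have "(\<integral>\<^sup>+ y. \<integral>\<^sup>+ x. h (V (f(b' := y, b := x))) \<partial>lborel \<partial>lborel)
       \<le> (\<integral>\<^sup>+ y. ennreal C * indicator {y0 - l1 .. y0 + l1} y \<partial>lborel)"
    proof (intro nn_integral_mono)
      fix y
      show "(\<integral>\<^sup>+ x. h (V (f(b' := y, b := x))) \<partial>lborel) \<le> ennreal C * indicator {y0 - l1 .. y0 + l1} y"
      proof (cases "\<exists>x. V (f(b' := y, b := x)) \<in> E")
        case False
        then have "h (V (f(b' := y, b := x))) = 0" for x by (auto simp: h_def)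
        then show ?thesis by simp
      next
        case True
        then obtain x where x: "V (f(b' := y, b := x)) \<in> E" by blast
        have "\<bar>V (f(b' := y, b := x)) \<bullet> b' - V (f(b' := y0, b := x0)) \<bullet> b'\<bar> \<le> l1"
          by (rule Eb'[OF x 0]) (auto simp: Ve)
        then have "\<bar>y - y0\<bar> \<le> l1" using b by (simp add: Ve)
        then show ?thesis using inner[of "f(b' := y)"] by (auto simp: abs_le_iff indicator_def)
      qed
    qed
    also have "\<dots> = ennreal (C * (2 * l1))"
      using l1 C0 by (subst nn_integral_cmult_indicator) (auto simp flip: ennreal_mult)
    finally show ?thesis using box by simp
  qed
  have "(\<integral>\<^sup>+ z. h z \<partial>lborel) = (\<integral>\<^sup>+ f. h (V f) \<partial>(\<Pi>\<^sub>M e\<in>Basis. lborel))"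
    unfolding lborel_eq[where 'a='a] V_def[symmetric] by (rule nn_integral_distr) measurable
  also have "\<dots> = (\<integral>\<^sup>+ f. h (V f) \<partial>(Pi\<^sub>M (insert b (insert b' B)) (\<lambda>_. lborel)))"
    by (simp only: B(4)[symmetric])
  \<comment> \<open>Tonelli is applied twice, with \<open>b\<close> innermost and \<open>b'\<close>
    next, to match \<open>inner\<close> and \<open>middle\<close>.\<close>
  also have "\<dots> = (\<integral>\<^sup>+ g. (\<integral>\<^sup>+ x. h (V (g(b := x))) \<partial>lborel) \<partial>(Pi\<^sub>M (insert b' B) (\<lambda>_. lborel)))"
    by (rule product_nn_integral_insert[OF _ B(3) hV_meas]) (use B in auto)
  also have "\<dots> = (\<integral>\<^sup>+ f. (\<integral>\<^sup>+ y. \<integral>\<^sup>+ x. h (V (f(b' := y, b := x))) \<partial>lborel \<partial>lborel) \<partial>(Pi\<^sub>M B (\<lambda>_. lborel)))"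
  proof (rule product_nn_integral_insert[OF B(1,2)])
    have [measurable]: "(\<lambda>(g, x). g(b := x)) \<in> measurable (Pi\<^sub>M (insert b' B) (\<lambda>_. lborel) \<Otimes>\<^sub>M lborel) (Pi\<^sub>M (insert b (insert b' B)) (\<lambda>_. lborel))"
      by (rule measurable_add_dim)
    have "(\<lambda>(g, x). h (V (g(b := x)))) \<in> borel_measurable (Pi\<^sub>M (insert b' B) (\<lambda>_. lborel) \<Otimes>\<^sub>M lborel)"
      using measurable_compose[OF _ hV_meas, of "\<lambda>(g, x). g(b := x)"] by (simp add: case_prod_unfold)
    then show "(\<lambda>g. \<integral>\<^sup>+ x. h (V (g(b := x))) \<partial>lborel) \<in> borel_measurable (Pi\<^sub>M (insert b' B) (\<lambda>_. lborel))"
      by (rule sigma_finite_measure.borel_measurable_nn_integral[OF sigma_finite_lborel])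
  qed
  also have "\<dots> \<le> (\<integral>\<^sup>+ f. ennreal (C * (2 * l1)) * indicator (Pi\<^sub>E B (\<lambda>e. {u \<bullet> e - l2 .. u \<bullet> e + l2})) f \<partial>(Pi\<^sub>M B (\<lambda>_. lborel)))"
    by (intro nn_integral_mono middle) (auto simp: space_PiM PiE_def)
  also have "\<dots> = ennreal (C * (2 * l1)) * (\<Prod>e\<in>B. ennreal (2 * l2))"
    using B(1) l2 by (subst nn_integral_cmult_indicator) (auto simp: emeasure_PiM intro!: sets_PiM_I_finite)
  also have "\<dots> = ennreal (C * (2 * l1) * (2 * l2) ^ (DIM('a) - 2))"
    using C0 l1 l2 by (simp add: cardB ennreal_power flip: ennreal_mult)
  finally show ?thesis by (simp add: h_def C_def)
qed

section \<open>Finiteness of the total weight of the ball\<close>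

lemma exists_large_coordinate:
  fixes a :: "'a::euclidean_space"
  obtains b where "b \<in> Basis" "norm a \<le> sqrt (real DIM('a)) * \<bar>a \<bullet> b\<bar>"
proof -
  define m where "m = Max ((\<lambda>e. (a \<bullet> e)\<^sup>2) ` Basis)"
  have "m \<in> (\<lambda>e. (a \<bullet> e)\<^sup>2) ` Basis" unfolding m_def by (intro Max_in) auto
  then obtain b where b: "b \<in> Basis" "(a \<bullet> b)\<^sup>2 = m" by auto
  have m: "(a \<bullet> e)\<^sup>2 \<le> m" if "e \<in> Basis" for e unfolding m_def using that by (intro Max_ge) auto
  \<comment> \<open>The largest squared coordinate is at least the mean of all of them.\<close>
  have "(norm a)\<^sup>2 = (\<Sum>e\<in>Basis. (a \<bullet> e)\<^sup>2)"
    unfolding power2_norm_eq_inner by (subst euclidean_inner) (simp add: power2_eq_square)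
  also have "\<dots> \<le> real DIM('a) * (a \<bullet> b)\<^sup>2" unfolding b(2) using m by (intro sum_bounded_above)
  finally have "norm a \<le> sqrt (real DIM('a) * (a \<bullet> b)\<^sup>2)" by (rule real_le_rsqrt)
  then show ?thesis using b(1) that by (simp add: real_sqrt_mult)
qed

text \<open>On the ball of radius 1/2 the weight is bounded. Every other point of the unit ball has
  a coordinate of modulus at least \<open>c\<close>, so finitely many sets \<open>E b\<close> cover
  the rest, and the sliced bound applies to each. Dimension at least 2 supplies the second direction
  \<open>b'\<close>.\<close>

lemma nn_integral_ball_weight_finite:
  fixes \<alpha> :: real
  assumes \<alpha>: "\<alpha> > -1" and D: "DIM('a::euclidean_space) \<ge> 2"
  shows "(\<integral>\<^sup>+ z. ennreal (indicator (ball (0::'a) 1) z * (1 - (norm z)\<^sup>2) powr \<alpha>) \<partial>lborel) < \<infinity>"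
proof -
  define c where "c = 1 / (2 * sqrt (real DIM('a)))"
  have c: "c > 0" by (simp add: c_def)
  define E where "E = (\<lambda>b. {z::'a. norm z < 1 \<and> c \<le> \<bar>z \<bullet> b\<bar>})"
  have E_meas [measurable]: "E b \<in> sets borel" for b unfolding E_def by measurable
  \<comment> \<open>Bounds the weight where \<open>3/4 \<le> 1 - |z|^2 \<le> 1\<close>, for either
    sign of \<alpha>.\<close>
  define K where "K = 1 + (3/4) powr \<alpha>"
  have K0: "K \<ge> 0" by (simp add: K_def)
  define g :: "'a \<Rightarrow> real" where "g = (\<lambda>z. (1 - (norm z)\<^sup>2) powr \<alpha>)"
  have g_meas [measurable]: "g \<in> borel_measurable borel" unfolding g_def by measurable
  have g0: "g z \<ge> 0" for z by (simp add: g_def)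
  have pw: "indicator (ball 0 1) z * g z \<le> K * indicator (ball 0 1) z + (\<Sum>b\<in>Basis. indicator (E b) z * g z)" for z
  proof (cases "norm z < 1")
    case z: True
    show ?thesis
    proof (cases "norm z < 1/2")
      case True
      then have "(norm z)\<^sup>2 \<le> (1/2)\<^sup>2" by (intro power_mono) auto
      then have n: "3/4 \<le> 1 - (norm z)\<^sup>2" "1 - (norm z)\<^sup>2 \<le> 1" by (auto simp: power2_eq_square)
      have "g z \<le> K"
      proof (cases "\<alpha> \<ge> 0")
        case True
        then have "g z \<le> 1 powr \<alpha>" unfolding g_def using n by (intro powr_mono2) auto
        then show ?thesis by (simp add: K_def add_increasing2)
      next
        case False
        then have "g z \<le> (3/4) powr \<alpha>" unfolding g_def using n by (intro powr_mono2') auto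
        then show ?thesis by (simp add: K_def)
      qed
      then show ?thesis using z g0 by (simp add: add_increasing2 sum_nonneg)
    next
      case False
      obtain b where b: "b \<in> Basis" "norm z \<le> sqrt (real DIM('a)) * \<bar>z \<bullet> b\<bar>"
        using exists_large_coordinate by blast
      have "1/2 \<le> sqrt (real DIM('a)) * \<bar>z \<bullet> b\<bar>" using False b by linarith
      then have "c \<le> \<bar>z \<bullet> b\<bar>" by (simp add: c_def field_simps)
      then have "z \<in> E b" using z by (simp add: E_def)
      then have "g z \<le> (\<Sum>b\<in>Basis. indicator (E b) z * g z)"
        using member_le_sum[OF b(1), of "\<lambda>b. indicator (E b) z * g z"] g0 by simp
      then show ?thesis using z K0 by simp
    qed
  qed (use g0 in \<open>auto simp: sum_nonneg\<close>)
  have Efin: "(\<integral>\<^sup>+ z. ennreal (indicator (E b) z * g z) \<partial>lborel) < \<infinity>" if b: "b \<in> Basis" for b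
  proof -
    obtain b' :: 'a where b': "b' \<in> Basis" "b \<noteq> b'"
    proof -
      have "\<not> Basis \<subseteq> {b}" using D card_mono[of "{b}" "Basis :: 'a set"] by auto
      then show ?thesis using that by blast
    qed
    have le: "\<bar>z \<bullet> e\<bar> \<le> 1" if "z \<in> E b" "e \<in> Basis" for z e
      using that Basis_le_norm[of e z] by (auto simp: E_def)
    \<comment> \<open>Crude parameters suffice: all coordinates lie in \<open>[-1, 1]\<close>, so
      \<open>\<tau> = 1\<close>, \<open>l1 = 2\<close>, \<open>l2 = 1\<close> and
      \<open>u = 0\<close>.\<close>
    have "(\<integral>\<^sup>+ z. ennreal (indicator (E b) z * g z) \<partial>lborel)
     \<le> ennreal (2 * (c powr \<alpha> + 2 powr \<alpha>) / c powr (\<alpha> + 1) / (\<alpha> + 1) * 1 powr (\<alpha> + 1)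
        * (2 * 2) * (2 * 1) ^ (DIM('a) - 2))"
      unfolding g_def
    proof (rule nn_integral_ball_weight_le[OF \<alpha> c E_meas b b', where u = 0])
      fix z w assume "z \<in> E b" "w \<in> E b"
      then show "\<bar>z \<bullet> b' - w \<bullet> b'\<bar> \<le> 2" using le[of z b'] le[of w b'] b' by linarith
    qed (use le in \<open>auto simp: E_def\<close>)
    then show ?thesis by (rule le_less_trans) auto
  qed
  have "(\<integral>\<^sup>+ z. ennreal (indicator (ball (0::'a) 1) z * g z) \<partial>lborel) \<le>
      (\<integral>\<^sup>+ z. ennreal K * indicator (ball 0 1) z + (\<Sum>b\<in>Basis. ennreal (indicator (E b) z * g z)) \<partial>lborel)"
  proof (intro nn_integral_mono)
    fix z :: 'a
    have "ennreal (indicator (ball 0 1) z * g z) \<le> ennreal (K * indicator (ball 0 1) z + (\<Sum>b\<in>Basis. indicator (E b) z * g z))"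
      by (intro ennreal_leI pw)
    also have "\<dots> = ennreal K * indicator (ball 0 1) z + (\<Sum>b\<in>Basis. ennreal (indicator (E b) z * g z))"
    proof (subst ennreal_plus)
      show "ennreal (K * indicator (ball 0 1) z) + ennreal (\<Sum>b\<in>Basis. indicator (E b) z * g z)
        = ennreal K * indicator (ball 0 1) z + (\<Sum>b\<in>Basis. ennreal (indicator (E b) z * g z))"
        using K0 g0 by (subst sum_ennreal) (simp_all add: ennreal_mult ennreal_indicator)
    qed (use K0 g0 in \<open>simp_all add: sum_nonneg\<close>)
    finally show "ennreal (indicator (ball 0 1) z * g z) \<le> ennreal K * indicator (ball 0 1) z + (\<Sum>b\<in>Basis. ennreal (indicator (E b) z * g z))" .
  qed
  also have "\<dots> = ennreal K * emeasure lborel (ball (0::'a) 1) + (\<Sum>b\<in>Basis. \<integral>\<^sup>+ z. ennreal (indicator (E b) z * g z) \<partial>lborel)"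
    by (subst nn_integral_add)
       (auto simp: nn_integral_sum nn_integral_cmult_indicator
         intro!: borel_measurable_times_ennreal borel_measurable_indicator)
  also have "\<dots> < \<infinity>"
    using Efin emeasure_lborel_ball_finite[of "0::'a" 1] by (auto simp: ennreal_mult_less_top)
  finally show ?thesis by (simp add: g_def)
qed

section \<open>The Forelli-Rudin estimate\<close>

lemma Re_herm: "Re (herm z w) = z \<bullet> w"
  by (simp add: herm_def inner_vec_def inner_complex_def)

lemma herm_self: "herm a a = of_real ((norm a)\<^sup>2)"
  by (simp add: complex_eq_iff Re_herm power2_norm_eq_inner) (simp add: herm_def)

lemma cmod_herm_le: "cmod (herm z w) \<le> norm z * norm w"
proof -
  have "cmod (herm z w) \<le> (\<Sum>j\<in>UNIV. \<bar>cmod (z$j)\<bar> * \<bar>cmod (w$j)\<bar>)"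
    unfolding herm_def by (rule order_trans[OF norm_sum]) (simp add: norm_mult)
  also have "\<dots> \<le> norm z * norm w" unfolding norm_vec_def by (rule L2_set_mult_ineq)
  finally show ?thesis .
qed

lemma bounded_linear_herm: "bounded_linear (\<lambda>z. herm z w)"
proof (rule bounded_linear_intro)
  show "cmod (herm z w) \<le> norm z * norm w" for z by (rule cmod_herm_le)
qed (simp_all add: herm_def algebra_simps sum.distrib scaleR_sum_right)

lemma herm_scale: "herm (c *s z) w = c * herm z w"
  by (simp add: herm_def sum_distrib_left mult_ac)

lemma borel_measurable_herm [measurable]: "(\<lambda>z. herm z w) \<in> borel_measurable borel"
  by (intro borel_measurable_continuous_onI bounded_linear.continuous_on[OF bounded_linear_herm] continuous_intros)

text \<open>\<open>b\<close> is the real or imaginary direction of a complex coordinate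
  \<open>i\<close>, and \<open>b'\<close> is the other one. Fixing every further real coordinate
  therefore fixes all complex coordinates except the \<open>i\<close>-th.\<close>

lemma Basis_complex_vec_cases:
  fixes b :: "complex^'n"
  assumes "b \<in> Basis"
  obtains i b' where "b' \<in> Basis" "b \<noteq> b'" "\<And>z. \<bar>z \<bullet> b\<bar> \<le> cmod (z $ i)" "\<And>z. \<bar>z \<bullet> b'\<bar> \<le> cmod (z $ i)"
    "\<And>z w j. (\<And>e. e \<in> Basis - {b, b'} \<Longrightarrow> z \<bullet> e = w \<bullet> e) \<Longrightarrow> j \<noteq> i \<Longrightarrow> z $ j = w $ j"
proof -
  obtain i where i: "b = axis i 1 \<or> b = axis i \<i>"
    using assms by (auto simp: Basis_vec_def Basis_complex_def)
  define b' :: "complex^'n" where "b' = (if b = axis i 1 then axis i \<i> else axis i 1)"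
  have bb: "{b, b'} = {axis i 1, axis i \<i>}" using i by (auto simp: b'_def)
  have "b' \<in> Basis" by (auto simp: b'_def Basis_vec_def Basis_complex_def)
  moreover have "b \<noteq> b'" using i by (auto simp: b'_def axis_eq_axis)
  moreover have ax: "\<bar>z \<bullet> e\<bar> \<le> cmod (z $ i)" if "e \<in> {axis i 1, axis i \<i>}" for e z
    using that abs_Re_le_cmod[of "z $ i"] abs_Im_le_cmod[of "z $ i"] by (auto simp: inner_axis inner_complex_def)
  moreover have "z $ j = w $ j" if eq: "\<And>e. e \<in> Basis - {b, b'} \<Longrightarrow> z \<bullet> e = w \<bullet> e" and "j \<noteq> i" for z w j
  proof -
    have "(axis j 1 :: complex^'n) \<in> Basis - {b, b'}" "(axis j \<i> :: complex^'n) \<in> Basis - {b, b'}"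
      unfolding bb using \<open>j \<noteq> i\<close> by (auto simp: Basis_vec_def Basis_complex_def axis_eq_axis)
    from this[THEN eq] show ?thesis by (simp add: inner_axis inner_complex_def complex_eq_iff)
  qed
  ultimately show ?thesis using that[of b' i] bb by blast
qed

text \<open>By Cauchy-Schwarz and the reverse triangle inequality. This form is uniform in
  \<open>z\<close>; the next one is uniform in \<open>a\<close>.\<close>

lemma one_minus_norm_right_le_cmod:
  assumes "norm z \<le> 1"
  shows "1 - norm a \<le> cmod (1 - herm z a)"
proof -
  have "norm z * norm a \<le> norm a" using assms by (simp add: mult_left_le_one_le)
  then have "cmod (herm z a) \<le> norm a" using cmod_herm_le[of z a] by linarith
  then show ?thesis using norm_triangle_ineq2[of 1 "herm z a"] by simp
qed

lemma one_minus_norm_left_le_cmod: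
  assumes "norm a \<le> 1"
  shows "1 - norm z \<le> cmod (1 - herm z a)"
proof -
  have "norm z * norm a \<le> norm z" using assms by (simp add: mult_left_le)
  then have "cmod (herm z a) \<le> norm z" using cmod_herm_le[of z a] by linarith
  then show ?thesis using norm_triangle_ineq2[of 1 "herm z a"] by simp
qed

text \<open>For large \<open>t\<close> the total weight of the ball suffices. For small
  \<open>t\<close> a nonempty region forces \<open>a\<close> away from 0 and \<open>z\<close> close
  to \<open>a\<close>, so a large coordinate of \<open>a\<close> stays large at \<open>z\<close> and
  the sliced bound applies.\<close>

lemma nn_integral_koranyi_region_le:
  fixes \<alpha> :: real
  assumes \<alpha>: "\<alpha> > -1"
  obtains C where "C \<ge> 0"
    "\<And>(a::complex^'n) t. norm a < 1 \<Longrightarrow> t > 0 \<Longrightarrow>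
      (\<integral>\<^sup>+ z. ennreal (indicator {z. norm z < 1 \<and> cmod (1 - herm z a) < t} z * (1 - (norm z)\<^sup>2) powr \<alpha>) \<partial>lborel)
      \<le> ennreal (C * t powr (real CARD('n) + 1 + \<alpha>))"
proof -
  define n where "n = CARD('n)"
  have n: "n > 0" by (simp add: n_def)
  define N where "N = real n + 1 + \<alpha>"
  have N: "N > 0" using n \<alpha> by (simp add: N_def)
  have D: "DIM(complex^'n) = 2 * n" by (simp add: n_def)
  \<comment> \<open>If \<open>norm a \<ge> 1/2\<close>, some real coordinate of \<open>a\<close> has
    modulus at least \<open>(1/2) / sqrt (2 n) = 2 * c\<close>. Half of it remains at
    \<open>z\<close> when \<open>|z - a| \<le> c\<close>, and \<open>t0\<close> is chosen so that
    \<open>sqrt (2 * t) \<le> c\<close> for \<open>t \<le> t0\<close>.\<close>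
  define c where "c = 1 / (4 * sqrt (real (2 * n)))"
  have c: "c > 0" using n by (simp add: c_def)
  define t0 where "t0 = c\<^sup>2 / 2"
  have t0: "t0 > 0" using c by (simp add: t0_def)
  have c2: "c\<^sup>2 = 1 / (32 * real n)" using n by (simp add: c_def power_divide power_mult_distrib)
  have "c\<^sup>2 \<le> 1" using n unfolding c2 by (simp add: field_simps)
  then have t0': "t0 \<le> 1/2" by (simp add: t0_def)
  define Q where "Q = 2 * (c powr \<alpha> + 2 powr \<alpha>) / c powr (\<alpha> + 1) / (\<alpha> + 1)"
  have Q: "Q \<ge> 0" using \<alpha> by (simp add: Q_def)
  \<comment> \<open>The powers of \<open>t\<close> are stripped off:
    \<open>2 powr (\<alpha> + 1)\<close> comes from \<open>\<tau> = 2 * t\<close>,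
    \<open>2 / c\<close> from \<open>l1 = t / c\<close>, and \<open>8 ^ (n - 1)\<close> from
    \<open>2 n - 2\<close> factors \<open>2 * sqrt (2 * t)\<close>.\<close>
  define C1 where "C1 = Q * 2 powr (\<alpha> + 1) * (2 / c) * 8 ^ (n - 1)"
  have C1: "C1 \<ge> 0" using Q c by (simp add: C1_def)
  obtain A where A: "A \<ge> 0" "(\<integral>\<^sup>+ z. ennreal (indicator (ball (0::complex^'n) 1) z * (1 - (norm z)\<^sup>2) powr \<alpha>) \<partial>lborel) = ennreal A"
    using nn_integral_ball_weight_finite[OF \<alpha>, where 'a="complex^'n"] n D
    by (cases "\<integral>\<^sup>+ z. ennreal (indicator (ball (0::complex^'n) 1) z * (1 - (norm z)\<^sup>2) powr \<alpha>) \<partial>lborel" rule: ennreal_cases) auto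
  \<comment> \<open>The second summand serves \<open>t > t0\<close>, where it makes the bound exceed
    the total weight \<open>A\<close>.\<close>
  define C where "C = C1 + A / t0 powr N"
  have "C \<ge> 0" using C1 A by (simp add: C_def)
  moreover have "(\<integral>\<^sup>+ z. ennreal (indicator {z. norm z < 1 \<and> cmod (1 - herm z a) < t} z * (1 - (norm z)\<^sup>2) powr \<alpha>) \<partial>lborel)
      \<le> ennreal (C * t powr (real CARD('n) + 1 + \<alpha>))" (is "?I \<le> _") if a: "norm a < 1" and t: "t > 0" for a :: "complex^'n" and t
  proof (cases "t \<le> t0")
    case False
    have "?I \<le> (\<integral>\<^sup>+ z. ennreal (indicator (ball (0::complex^'n) 1) z * (1 - (norm z)\<^sup>2) powr \<alpha>) \<partial>lborel)"
      by (intro nn_integral_mono) (auto simp: indicator_def)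
    also have "\<dots> = ennreal A" by (rule A)
    also have "\<dots> \<le> ennreal (C * t powr N)"
    proof (rule ennreal_leI)
      have "t0 powr N \<le> t powr N" using False t0 N by (intro powr_mono2) auto
      then have "A \<le> A / t0 powr N * t powr N" using A t0 by (simp add: field_simps mult_left_mono)
      also have "\<dots> \<le> C * t powr N" using C1 by (intro mult_right_mono) (auto simp: C_def)
      finally show "A \<le> C * t powr N" .
    qed
    finally show ?thesis by (simp add: N_def n_def)
  next
    case True
    define E where "E = {z::complex^'n. norm z < 1 \<and> cmod (1 - herm z a) < t}"
    have E_meas: "E \<in> sets borel" unfolding E_def by measurable
    show ?thesis
    proof (cases "E = {}")
      case True
      then show ?thesis unfolding E_def[symmetric] by simp
    next
      case False
      then obtain z0 where z0: "norm z0 < 1" "cmod (1 - herm z0 a) < t" by (auto simp: E_def)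
      have a2: "norm a \<ge> 1/2" using one_minus_norm_right_le_cmod[of z0 a] z0 True t0' by linarith
      obtain b where b: "b \<in> Basis" "norm a \<le> sqrt (real (2 * n)) * \<bar>a \<bullet> b\<bar>"
        using exists_large_coordinate[of a] unfolding D by blast
      have "1/2 \<le> sqrt (real (2 * n)) * \<bar>a \<bullet> b\<bar>" using b a2 by linarith
      then have ab: "2 * c \<le> \<bar>a \<bullet> b\<bar>" using n by (simp add: c_def field_simps)
      obtain i b' where b': "b' \<in> Basis" "b \<noteq> b'" "\<And>z. \<bar>z \<bullet> b\<bar> \<le> cmod (z $ i)" "\<And>z. \<bar>z \<bullet> b'\<bar> \<le> cmod (z $ i)"
        and eq: "\<And>z w j. (\<And>e. e \<in> Basis - {b, b'} \<Longrightarrow> z \<bullet> e = w \<bullet> e) \<Longrightarrow> j \<noteq> i \<Longrightarrow> z $ j = w $ j"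
        by (rule Basis_complex_vec_cases[OF b(1)]) blast
      have ai: "2 * c \<le> cmod (a $ i)" using ab b'(3)[of a] by linarith
      \<comment> \<open>Expand \<open>|z - a|^2 = |z|^2 + |a|^2 - 2 * (z \<bullet> a)\<close>, with
        both squared norms at most 1, and use that the real part of \<open>1 - herm z a\<close> is
        below \<open>t\<close>.\<close>
      have dist: "norm (z - a) \<le> sqrt (2 * t)" if "z \<in> E" for z
      proof (rule real_le_rsqrt)
        have z: "norm z < 1" "cmod (1 - herm z a) < t" using that by (auto simp: E_def)
        have "(norm z)\<^sup>2 \<le> 1" "(norm a)\<^sup>2 \<le> 1" using z a by (auto simp: abs_square_le_1)
        then have "(norm (z - a))\<^sup>2 \<le> 2 * (1 - z \<bullet> a)"
          by (simp add: power2_norm_eq_inner inner_diff inner_commute)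
        also have "1 - z \<bullet> a \<le> t" using z complex_Re_le_cmod[of "1 - herm z a"] by (simp add: Re_herm)
        finally show "(norm (z - a))\<^sup>2 \<le> 2 * t" by simp
      qed
      have st: "sqrt (2 * t) \<le> c" using True c by (intro real_le_lsqrt) (auto simp: t0_def)
      have "(\<integral>\<^sup>+ z. ennreal (indicator E z * (1 - (norm z)\<^sup>2) powr \<alpha>) \<partial>lborel)
         \<le> ennreal (Q * (2 * t) powr (\<alpha> + 1) * (2 * (t / c)) * (2 * sqrt (2 * t)) ^ (DIM(complex^'n) - 2))"
        unfolding Q_def
      proof (rule nn_integral_ball_weight_le[OF \<alpha> c E_meas b(1) b'(1,2), where u = a])
        fix z assume z: "z \<in> E"
        have "\<bar>(z - a) \<bullet> b\<bar> \<le> c" using Basis_le_norm[OF b(1), of "z - a"] dist[OF z] st by linarith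
        then have "c \<le> \<bar>z \<bullet> b\<bar>" using ab by (simp add: inner_diff_left)
        moreover have "1 - (norm z)\<^sup>2 \<le> 2 * t"
        proof -
          have z1: "norm z < 1" using z by (simp add: E_def)
          have "1 - norm z \<le> t" using one_minus_norm_left_le_cmod[of a z] a z by (simp add: E_def)
          have "1 - (norm z)\<^sup>2 = (1 - norm z) * (1 + norm z)" by (simp add: power2_eq_square algebra_simps)
          also have "\<dots> \<le> (1 - norm z) * 2" using z1 by (intro mult_left_mono) auto
          also have "\<dots> \<le> 2 * t" using \<open>1 - norm z \<le> t\<close> by simp
          finally show ?thesis .
        qed
        ultimately show "norm z < 1 \<and> c \<le> \<bar>z \<bullet> b\<bar> \<and> 1 - (norm z)\<^sup>2 \<le> 2 * t" using z by (simp add: E_def)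
      next
        fix z w assume zw: "z \<in> E" "w \<in> E" "\<And>e. e \<in> Basis - {b, b'} \<Longrightarrow> z \<bullet> e = w \<bullet> e"
        \<comment> \<open>\<open>z\<close> and \<open>w\<close> differ only in the
          \<open>i\<close>-th complex coordinate, so one product remains. It is at most
          \<open>2 * t\<close>, as both points satisfy \<open>cmod (1 - herm _ a) < t\<close>;
          dividing by \<open>cmod (a $ i) \<ge> 2 * c\<close> gives \<open>t / c\<close>.\<close>
        have "herm (z - w) a = (\<Sum>j\<in>UNIV. if j = i then (z - w) $ i * cnj (a $ i) else 0)"
          unfolding herm_def by (intro sum.cong refl) (use eq[OF zw(3)] in auto)
        then have h: "herm (z - w) a = (z - w) $ i * cnj (a $ i)" by simp
        have "herm (z - w) a = (1 - herm w a) - (1 - herm z a)"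
          using linear_diff[OF bounded_linear.linear[OF bounded_linear_herm[of a]], of z w] by simp
        then have "cmod (herm (z - w) a) \<le> cmod (1 - herm w a) + cmod (1 - herm z a)"
          by (simp only: norm_triangle_ineq4)
        then have "cmod ((z - w) $ i) * cmod (a $ i) \<le> 2 * t" using zw(1,2) by (simp add: h E_def norm_mult)
        moreover have "cmod ((z - w) $ i) * (2 * c) \<le> cmod ((z - w) $ i) * cmod (a $ i)"
          using ai by (intro mult_left_mono) auto
        ultimately have "cmod ((z - w) $ i) * c \<le> t" by linarith
        then have "cmod ((z - w) $ i) \<le> t / c" using c by (simp add: field_simps)
        then show "\<bar>z \<bullet> b' - w \<bullet> b'\<bar> \<le> t / c" using b'(4)[of "z - w"] by (simp add: inner_diff_left)
      next
        fix z e assume z: "z \<in> E" and e: "e \<in> Basis - {b, b'}"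
        show "\<bar>z \<bullet> e - a \<bullet> e\<bar> \<le> sqrt (2 * t)"
          using Basis_le_norm[of e "z - a"] e dist[OF z] by (simp add: inner_diff_left)
      qed (use t c in auto)
      also have "Q * (2 * t) powr (\<alpha> + 1) * (2 * (t / c)) * (2 * sqrt (2 * t)) ^ (DIM(complex^'n) - 2) = C1 * t powr N"
      proof -
        have "(2 * sqrt (2 * t)) ^ (DIM(complex^'n) - 2) = ((2 * sqrt (2 * t))\<^sup>2) ^ (n - 1)"
          unfolding D power_mult[symmetric] by (simp add: right_diff_distrib')
        also have "\<dots> = 8 ^ (n - 1) * t ^ (n - 1)" using t by (simp add: power_mult_distrib)
        also have "t ^ (n - 1) = t powr (real n - 1)" using t n by (simp add: powr_realpow[symmetric] of_nat_diff)
        finally have 1: "(2 * sqrt (2 * t)) ^ (DIM(complex^'n) - 2) = 8 ^ (n - 1) * t powr (real n - 1)" .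
        \<comment> \<open>The exponent splits as \<open>N = (\<alpha> + 1) + 1 + (n - 1)\<close>:
          slicing, the direction \<open>b'\<close>, and \<open>2 n - 2\<close> directions of size
          \<open>sqrt t\<close>.\<close>
        have "t powr N = t powr (\<alpha> + 1) * (t powr 1 * t powr (real n - 1))"
          unfolding powr_add[symmetric] by (simp add: N_def add_ac)
        then have 2: "t powr N = t powr (\<alpha> + 1) * (t * t powr (real n - 1))" using t by simp
        show ?thesis unfolding 1 2 C1_def using t by (simp add: powr_mult)
      qed
      also have "ennreal (C1 * t powr N) \<le> ennreal (C * t powr N)"
        using A by (intro ennreal_leI mult_right_mono) (auto simp: C_def)
      finally show ?thesis by (simp add: N_def n_def E_def)
    qed
  qed
  ultimately show ?thesis using that by blast
qed

text \<open>Split the ball into dyadic shells of \<open>cmod (1 - herm z a)\<close>. A shell at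
  scale \<open>T\<close> contributes at most a constant times
  \<open>T powr - (m + N) * T powr N = T powr - m\<close>, a geometric series since
  \<open>m > 0\<close>, dominated by the smallest scale.\<close>

lemma forelli_rudin_estimate:
  fixes \<alpha> m :: real
  assumes \<alpha>: "\<alpha> > -1" and m: "m > 0"
  obtains C where "C \<ge> 0"
    "\<And>a::complex^'n. norm a < 1 \<Longrightarrow>
      (\<integral>\<^sup>+ z. ennreal (indicator unit_ball z * (1 - (norm z)\<^sup>2) powr \<alpha>
          * cmod (1 - herm z a) powr - (m + (real CARD('n) + 1 + \<alpha>))) \<partial>lborel)
      \<le> ennreal (C * (1 - (norm a)\<^sup>2) powr - m)"
proof -
  define N where "N = real CARD('n) + 1 + \<alpha>"
  obtain C where C: "C \<ge> 0"
    "\<And>(a::complex^'n) t. norm a < 1 \<Longrightarrow> t > 0 \<Longrightarrow>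
      (\<integral>\<^sup>+ z. ennreal (indicator {z. norm z < 1 \<and> cmod (1 - herm z a) < t} z * (1 - (norm z)\<^sup>2) powr \<alpha>) \<partial>lborel)
      \<le> ennreal (C * t powr N)"
    unfolding N_def using nn_integral_koranyi_region_le[OF \<alpha>, where 'n='n] by blast
  define \<rho> where "\<rho> = (2::real) powr - m"
  have \<rho>: "0 < \<rho>" "\<rho> < 1" using m by (auto simp: \<rho>_def powr_less_one)
  \<comment> \<open>\<open>2 powr N\<close> pays for the outer radius \<open>T (Suc i)\<close>,
    \<open>2 powr m\<close> for the 2 in \<epsilon>, and \<open>1 / (1 - \<rho>)\<close> is the
    geometric sum.\<close>
  define C' where "C' = C * 2 powr N * 2 powr m / (1 - \<rho>)"
  have "C' \<ge> 0" using C \<rho> by (simp add: C'_def)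
  moreover have "(\<integral>\<^sup>+ z. ennreal (indicator unit_ball z * (1 - (norm z)\<^sup>2) powr \<alpha>
          * cmod (1 - herm z a) powr - (m + N)) \<partial>lborel)
      \<le> ennreal (C' * (1 - (norm a)\<^sup>2) powr - m)" if a: "norm a < 1" for a :: "complex^'n"
  proof -
    \<comment> \<open>The smallest scale:
      \<open>cmod (1 - herm z a) \<ge> 1 - norm a \<ge> \<epsilon>\<close> throughout the
      ball.\<close>
    define \<epsilon> where "\<epsilon> = (1 - (norm a)\<^sup>2) / 2"
    have "(norm a)\<^sup>2 < 1" using a by (simp add: abs_square_less_1)
    then have \<epsilon>: "\<epsilon> > 0" by (simp add: \<epsilon>_def)
    have "1 - (norm a)\<^sup>2 = (1 - norm a) * (1 + norm a)" by (simp add: power2_eq_square algebra_simps)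
    also have "\<dots> \<le> (1 - norm a) * 2" using a by (intro mult_left_mono) auto
    finally have \<epsilon>': "\<epsilon> \<le> 1 - norm a" by (simp add: \<epsilon>_def)
    define T where "T = (\<lambda>i::nat. 2 ^ i * \<epsilon>)"
    have T: "T i > 0" for i using \<epsilon> by (simp add: T_def)
    \<comment> \<open>The full region of radius \<open>T (Suc i)\<close>, which contains the shell
      from \<open>T i\<close> to \<open>T (Suc i)\<close>; overlaps only enlarge the upper
      bound.\<close>
    define E where "E = (\<lambda>i. {z::complex^'n. norm z < 1 \<and> cmod (1 - herm z a) < T (Suc i)})"
    have E_meas [measurable]: "E i \<in> sets borel" for i unfolding E_def by measurable
    define g :: "complex^'n \<Rightarrow> real" where "g = (\<lambda>z. (1 - (norm z)\<^sup>2) powr \<alpha>)"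
    have g_meas [measurable]: "g \<in> borel_measurable borel" unfolding g_def by measurable
    have g0: "g z \<ge> 0" for z by (simp add: g_def)
    have N0: "N > 0" using \<alpha> by (simp add: N_def add_pos_pos)
    have pw: "ennreal (indicator unit_ball z * g z * cmod (1 - herm z a) powr - (m + N))
       \<le> (\<Sum>i. ennreal (T i powr - (m + N)) * ennreal (indicator (E i) z * g z))" for z
    proof (cases "norm z < 1")
      case z: True
      define q where "q = cmod (1 - herm z a)"
      have q: "\<epsilon> \<le> q" using one_minus_norm_right_le_cmod[of z a] z \<epsilon>' by (simp add: q_def)
      obtain k where "q / \<epsilon> < 2 ^ k" using real_arch_pow[of 2 "q / \<epsilon>"] by auto
      then have "q < T k" using \<epsilon> by (simp add: T_def field_simps)
      then have ex: "\<exists>k. q < T k" by blast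
      \<comment> \<open>The least scale above \<open>q\<close> is not the zeroth, since
        \<open>T 0 = \<epsilon> \<le> q\<close>; its predecessor bounds \<open>q\<close> from
        below.\<close>
      define k0 where "k0 = (LEAST k. q < T k)"
      have k0: "q < T k0" unfolding k0_def using ex by (rule LeastI_ex)
      have "k0 \<noteq> 0" using k0 q by (intro notI) (simp add: T_def)
      then obtain i where i: "k0 = Suc i" using not0_implies_Suc by blast
      have "\<not> q < T i" using not_less_Least[of i "\<lambda>k. q < T k"] i unfolding k0_def by auto
      then have "q powr - (m + N) \<le> T i powr - (m + N)" using T N0 m by (intro powr_mono2') auto
      then have "ennreal (indicator unit_ball z * g z * q powr - (m + N)) \<le> ennreal (T i powr - (m + N) * (indicator (E i) z * g z))"
        using z k0 i g0[of z] by (intro ennreal_leI) (simp add: unit_ball_def E_def q_def mult.commute mult_left_mono)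
      also have "\<dots> = ennreal (T i powr - (m + N)) * ennreal (indicator (E i) z * g z)"
        using g0 by (subst ennreal_mult) auto
      also have "\<dots> \<le> (\<Sum>i. ennreal (T i powr - (m + N)) * ennreal (indicator (E i) z * g z))"
        using sum_le_suminf[OF summableI, of "{i}" "\<lambda>i. ennreal (T i powr - (m + N)) * ennreal (indicator (E i) z * g z)"] by simp
      finally show ?thesis by (simp add: q_def)
    qed (simp add: unit_ball_def)
    have "(\<integral>\<^sup>+ z. ennreal (indicator unit_ball z * g z * cmod (1 - herm z a) powr - (m + N)) \<partial>lborel)
      \<le> (\<integral>\<^sup>+ z. (\<Sum>i. ennreal (T i powr - (m + N)) * ennreal (indicator (E i) z * g z)) \<partial>lborel)"
      by (intro nn_integral_mono pw)
    also have "\<dots> = (\<Sum>i. \<integral>\<^sup>+ z. ennreal (T i powr - (m + N)) * ennreal (indicator (E i) z * g z) \<partial>lborel)"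
      by (rule nn_integral_suminf) measurable
    also have "\<dots> = (\<Sum>i. ennreal (T i powr - (m + N)) * (\<integral>\<^sup>+ z. ennreal (indicator (E i) z * g z) \<partial>lborel))"
      by (intro suminf_cong nn_integral_cmult) measurable
    also have "\<dots> \<le> (\<Sum>i. ennreal (T i powr - (m + N)) * ennreal (C * T (Suc i) powr N))"
      unfolding E_def g_def by (intro suminf_le summableI mult_left_mono C(2) a T) auto
    also have "\<dots> = (\<Sum>i. ennreal (C * 2 powr N * \<epsilon> powr - m * \<rho> ^ i))"
    proof (intro suminf_cong)
      fix i
      have "T (Suc i) powr N = 2 powr N * T i powr N"
        using powr_mult[of 2 "T i" N] by (simp add: T_def mult_ac)
      moreover have "T i powr - (m + N) * T i powr N = T i powr - m" by (simp flip: powr_add)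
      moreover have "T i powr - m = \<rho> ^ i * \<epsilon> powr - m"
      proof -
        have "(2 ^ i) powr - m = (\<rho>::real) ^ i"
          by (simp add: \<rho>_def powr_powr mult.commute flip: powr_realpow)
        then show ?thesis using \<epsilon> by (simp add: T_def powr_mult)
      qed
      ultimately have eq: "T i powr - (m + N) * (C * T (Suc i) powr N) = C * 2 powr N * \<epsilon> powr - m * \<rho> ^ i"
        by (simp add: mult_ac)
      show "ennreal (T i powr - (m + N)) * ennreal (C * T (Suc i) powr N) = ennreal (C * 2 powr N * \<epsilon> powr - m * \<rho> ^ i)"
        using C(1) by (simp only: eq ennreal_mult[symmetric] powr_ge_zero mult_nonneg_nonneg)
    qed
    also have "\<dots> = ennreal (C * 2 powr N * \<epsilon> powr - m * (1 / (1 - \<rho>)))"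
      using C(1) \<rho> by (intro suminf_ennreal_eq sums_mult geometric_sums) auto
    also have "C * 2 powr N * \<epsilon> powr - m * (1 / (1 - \<rho>)) = C' * (1 - (norm a)\<^sup>2) powr - m"
      using \<epsilon> by (simp add: C'_def \<epsilon>_def powr_divide powr_minus field_simps)
    finally show ?thesis by (simp add: g_def)
  qed
  ultimately show ?thesis using that unfolding N_def by blast
qed

section \<open>Inversion on a weighted sequence space\<close>

text \<open>On a weighted l1 space an operator is bounded by its column sums: sum
  \<open>F j k\<close> over \<open>k\<close> first, then exchange the order by absolute
  summability.\<close>

lemma weighted_l1_operator:
  fixes W :: "nat \<Rightarrow> real" and R :: "nat \<Rightarrow> nat \<Rightarrow> complex" and u :: "nat \<Rightarrow> complex"
  assumes W: "\<And>k. W k > 0"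
    and col: "\<And>j. (\<lambda>k. W k * cmod (R k j)) summable_on UNIV"
    and colb: "\<And>j. (\<Sum>\<^sub>\<infinity>k. W k * cmod (R k j)) \<le> \<kappa> * W j"
    and u: "(\<lambda>j. W j * cmod (u j)) summable_on UNIV"
  shows "(\<lambda>j. norm (R k j * u j)) summable_on UNIV"
    and "(\<lambda>k. W k * cmod (\<Sum>\<^sub>\<infinity>j. R k j * u j)) summable_on UNIV"
    and "(\<Sum>\<^sub>\<infinity>k. W k * cmod (\<Sum>\<^sub>\<infinity>j. R k j * u j)) \<le> \<kappa> * (\<Sum>\<^sub>\<infinity>j. W j * cmod (u j))"
proof -
  define g where "g = (\<lambda>j. (\<Sum>\<^sub>\<infinity>k. W k * cmod (R k j)) * cmod (u j))"
  define F where "F = (\<lambda>j k. W k * cmod (R k j) * cmod (u j))"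
  have F0: "F j k \<ge> 0" for j k using W[of k] by (simp add: F_def)
  have hs: "(F j has_sum g j) UNIV" for j
    unfolding F_def g_def by (intro has_sum_cmult_left has_sum_infsum col)
  have g0: "g j \<ge> 0" for j using hs[of j] F0 has_sum_nonneg by blast
  have gb: "g j \<le> \<kappa> * (W j * cmod (u j))" for j
    unfolding g_def using mult_right_mono[OF colb[of j] norm_ge_zero[of "u j"]] by (simp add: mult_ac)
  have ku: "(\<lambda>j. \<kappa> * (W j * cmod (u j))) summable_on UNIV" by (intro summable_on_cmult_right u)
  have gs: "g summable_on UNIV"
    by (rule summable_on_comparison_test[OF ku]) (use gb g0 in auto)
  have FS: "(\<lambda>(j,k). F j k) summable_on UNIV \<times> UNIV"
    by (rule summable_on_SigmaI[where g = g]) (use hs gs F0 in auto)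
  have FS': "(\<lambda>(k,j). F j k) summable_on UNIV \<times> UNIV"
    using FS summable_on_swap[of "\<lambda>(j,k). F j k" UNIV UNIV] by (simp add: case_prod_unfold)
  have row: "(\<lambda>j. F j k) summable_on UNIV" for k
    using summable_on_SigmaD1[OF FS', of k] by simp
  have abs: "(\<lambda>j. norm (R k j * u j)) summable_on UNIV" for k
  proof -
    have "(\<lambda>j. (1 / W k) * F j k) summable_on UNIV" by (intro summable_on_cmult_right row)
    moreover have "(1 / W k) * F j k = norm (R k j * u j)" for j
      using W[of k] by (simp add: F_def norm_mult)
    ultimately show ?thesis by simp
  qed
  then show "(\<lambda>j. norm (R k j * u j)) summable_on UNIV" .
  have rowb: "W k * cmod (\<Sum>\<^sub>\<infinity>j. R k j * u j) \<le> (\<Sum>\<^sub>\<infinity>j. F j k)" for k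
  proof -
    have "cmod (\<Sum>\<^sub>\<infinity>j. R k j * u j) \<le> (\<Sum>\<^sub>\<infinity>j. cmod (R k j * u j))"
      by (rule norm_infsum_bound[OF abs])
    then have "W k * cmod (\<Sum>\<^sub>\<infinity>j. R k j * u j) \<le> W k * (\<Sum>\<^sub>\<infinity>j. cmod (R k j * u j))"
      using W[of k] by simp
    also have "\<dots> = (\<Sum>\<^sub>\<infinity>j. F j k)"
      by (subst infsum_cmult_right[symmetric]) (use abs[of k] in \<open>auto simp: F_def norm_mult mult_ac\<close>)
    finally show ?thesis .
  qed
  have rs: "(\<lambda>k. \<Sum>\<^sub>\<infinity>j. F j k) summable_on UNIV"
    using summable_on_SigmaD[OF FS'] row by simp
  show s2: "(\<lambda>k. W k * cmod (\<Sum>\<^sub>\<infinity>j. R k j * u j)) summable_on UNIV"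
    by (rule summable_on_comparison_test[OF rs]) (use rowb W in \<open>auto intro!: mult_nonneg_nonneg less_imp_le[OF W]\<close>)
  have "(\<Sum>\<^sub>\<infinity>k. W k * cmod (\<Sum>\<^sub>\<infinity>j. R k j * u j)) \<le> (\<Sum>\<^sub>\<infinity>k. \<Sum>\<^sub>\<infinity>j. F j k)"
    by (intro infsum_mono s2 rs rowb)
  also have "\<dots> = (\<Sum>\<^sub>\<infinity>j. \<Sum>\<^sub>\<infinity>k. F j k)"
    by (rule infsum_swap_banach[OF FS'])
  also have "\<dots> = (\<Sum>\<^sub>\<infinity>j. g j)" using hs infsumI by (intro infsum_cong) blast
  also have "\<dots> \<le> (\<Sum>\<^sub>\<infinity>j. \<kappa> * (W j * cmod (u j)))" by (intro infsum_mono gs ku gb)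
  also have "\<dots> = \<kappa> * (\<Sum>\<^sub>\<infinity>j. W j * cmod (u j))" by (rule infsum_cmult_right) (use u in auto)
  finally show "(\<Sum>\<^sub>\<infinity>k. W k * cmod (\<Sum>\<^sub>\<infinity>j. R k j * u j)) \<le> \<kappa> * (\<Sum>\<^sub>\<infinity>j. W j * cmod (u j))" .
qed

text \<open>Solves \<open>(I + R) w = v\<close> by the series of \<open>(-R)^i v\<close>, whose
  weighted norms decay like \<open>\<kappa> ^ i\<close>.\<close>

lemma weighted_l1_neumann:
  fixes W :: "nat \<Rightarrow> real" and R :: "nat \<Rightarrow> nat \<Rightarrow> complex" and v :: "nat \<Rightarrow> complex"
  assumes W: "\<And>k. W k > 0"
    and col: "\<And>j. (\<lambda>k. W k * cmod (R k j)) summable_on UNIV"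
    and colb: "\<And>j. (\<Sum>\<^sub>\<infinity>k. W k * cmod (R k j)) \<le> \<kappa> * W j"
    and \<kappa>: "0 \<le> \<kappa>" "\<kappa> < 1"
    and v: "(\<lambda>j. W j * cmod (v j)) summable_on UNIV"
  obtains w where "(\<lambda>j. W j * cmod (w j)) summable_on UNIV"
    "\<And>k. (\<lambda>j. norm (R k j * w j)) summable_on UNIV"
    "\<And>k. w k + (\<Sum>\<^sub>\<infinity>j. R k j * w j) = v k"
proof -
  note op = weighted_l1_operator[OF W col colb]
  define u where "u = rec_nat v (\<lambda>_ x k. - (\<Sum>\<^sub>\<infinity>j. R k j * x j))"
  have u0: "u 0 = v" and uS: "u (Suc i) k = - (\<Sum>\<^sub>\<infinity>j. R k j * u i j)" for i k
    by (simp_all add: u_def)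
  define V where "V = (\<Sum>\<^sub>\<infinity>j. W j * cmod (v j))"
  have us: "(\<lambda>j. W j * cmod (u i j)) summable_on UNIV" for i
    by (induction i) (use v op(2) in \<open>auto simp: u0 uS\<close>)
  have ub: "(\<Sum>\<^sub>\<infinity>j. W j * cmod (u i j)) \<le> \<kappa> ^ i * V" for i
  proof (induction i)
    case (Suc i)
    have "(\<Sum>\<^sub>\<infinity>j. W j * cmod (u (Suc i) j)) \<le> \<kappa> * (\<Sum>\<^sub>\<infinity>j. W j * cmod (u i j))"
      using op(3)[OF us[of i]] by (simp add: uS)
    also have "\<dots> \<le> \<kappa> * (\<kappa> ^ i * V)" using Suc \<kappa> by (intro mult_left_mono)
    finally show ?case by simp
  qed (simp add: u0 V_def)
  define G where "G = (\<lambda>i j. W j * cmod (u i j))"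
  have G0: "G i j \<ge> 0" for i j using W[of j] by (simp add: G_def)
  have geo: "(\<lambda>i. \<kappa> ^ i * V) summable_on UNIV"
    by (rule norm_summable_imp_summable_on) (use \<kappa> in \<open>auto simp: abs_mult intro!: summable_mult2 summable_geometric\<close>)
  have gs: "(\<lambda>i. \<Sum>\<^sub>\<infinity>j. G i j) summable_on UNIV"
    by (rule summable_on_comparison_test[OF geo]) (use ub G0 in \<open>auto simp: G_def infsum_nonneg\<close>)
  have GS: "(\<lambda>(i,j). G i j) summable_on UNIV \<times> UNIV"
    by (rule summable_on_SigmaI[where g = "\<lambda>i. \<Sum>\<^sub>\<infinity>j. G i j"])
       (use us G0 gs in \<open>auto simp: G_def intro!: has_sum_infsum\<close>)
  have GS': "(\<lambda>(j,i). G i j) summable_on UNIV \<times> UNIV"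
    using GS summable_on_swap[of "\<lambda>(j,k). G j k" UNIV UNIV] by (simp add: case_prod_unfold)
  have Gcol: "(\<lambda>i. G i j) summable_on UNIV" for j
    using summable_on_SigmaD1[OF GS', of j] by simp
  have ua: "(\<lambda>i. norm (u i j)) summable_on UNIV" for j
  proof -
    have "(\<lambda>i. (1 / W j) * G i j) summable_on UNIV" by (intro summable_on_cmult_right Gcol)
    moreover have "(1 / W j) * G i j = norm (u i j)" for i
      using W[of j] by (simp add: G_def)
    ultimately show ?thesis by simp
  qed
  define w where "w = (\<lambda>j. \<Sum>\<^sub>\<infinity>i. u i j)"
  have wb: "W j * cmod (w j) \<le> (\<Sum>\<^sub>\<infinity>i. G i j)" for j
  proof -
    have "W j * cmod (w j) \<le> W j * (\<Sum>\<^sub>\<infinity>i. cmod (u i j))"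
      unfolding w_def using norm_infsum_bound[OF ua[of j]] W[of j] by simp
    also have "\<dots> = (\<Sum>\<^sub>\<infinity>i. G i j)"
      by (subst infsum_cmult_right[symmetric]) (use ua[of j] in \<open>auto simp: G_def\<close>)
    finally show ?thesis .
  qed
  have rs: "(\<lambda>j. \<Sum>\<^sub>\<infinity>i. G i j) summable_on UNIV"
    using summable_on_SigmaD[OF GS'] Gcol by simp
  have w1: "(\<lambda>j. W j * cmod (w j)) summable_on UNIV"
    by (rule summable_on_comparison_test[OF rs]) (use wb W in \<open>auto intro!: mult_nonneg_nonneg less_imp_le[OF W]\<close>)
  have "w k + (\<Sum>\<^sub>\<infinity>j. R k j * w j) = v k" for k
  proof -
    \<comment> \<open>A single entry is at most its column sum. This yields a multiple of the
      summable family \<open>G\<close> as majorant, which justifies exchanging the sums over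
      \<open>i\<close> and \<open>j\<close>.\<close>
    have Rb: "W k * cmod (R k j) \<le> \<kappa> * W j" for j
    proof -
      have "W k * cmod (R k j) = (\<Sum>\<^sub>\<infinity>l\<in>{k}. W l * cmod (R l j))" by simp
      also have "\<dots> \<le> (\<Sum>\<^sub>\<infinity>l. W l * cmod (R l j))"
        using W by (intro infsum_mono_neutral col) (auto intro!: mult_nonneg_nonneg less_imp_le[OF W])
      finally show ?thesis using colb[of j] by simp
    qed
    have "(\<lambda>x. norm (case x of (j,i) \<Rightarrow> R k j * u i j)) summable_on UNIV \<times> UNIV"
    proof (rule summable_on_comparison_test)
      show "(\<lambda>x. (\<kappa> / W k) * (case x of (j, i) \<Rightarrow> G i j)) summable_on UNIV \<times> UNIV"
        by (intro summable_on_cmult_right GS')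
      fix x :: "nat \<times> nat"
      obtain j i where x: "x = (j, i)" by force
      have "cmod (R k j) \<le> \<kappa> * W j / W k" using Rb[of j] W[of k] by (simp add: field_simps)
      then have "cmod (R k j) * cmod (u i j) \<le> \<kappa> * W j / W k * cmod (u i j)" by (intro mult_right_mono) auto
      then show "norm (case x of (j, i) \<Rightarrow> R k j * u i j) \<le> (\<kappa> / W k) * (case x of (j, i) \<Rightarrow> G i j)"
        by (simp add: x norm_mult G_def)
    qed auto
    then have sw: "(\<Sum>\<^sub>\<infinity>j. \<Sum>\<^sub>\<infinity>i. R k j * u i j) = (\<Sum>\<^sub>\<infinity>i. \<Sum>\<^sub>\<infinity>j. R k j * u i j)"
      by (rule infsum_swap_banach[OF abs_summable_summable])
    have "(\<Sum>\<^sub>\<infinity>j. R k j * w j) = (\<Sum>\<^sub>\<infinity>j. \<Sum>\<^sub>\<infinity>i. R k j * u i j)"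
      unfolding w_def by (intro infsum_cong infsum_cmult_right[symmetric] abs_summable_summable[OF ua])
    also have "\<dots> = (\<Sum>\<^sub>\<infinity>i. - u (Suc i) k)" by (simp add: sw uS)
    also have "\<dots> = - (\<Sum>\<^sub>\<infinity>i. u (Suc i) k)" by (rule infsum_uminus)
    finally have 1: "(\<Sum>\<^sub>\<infinity>j. R k j * w j) = - (\<Sum>\<^sub>\<infinity>i. u (Suc i) k)" .
    have sm: "(\<lambda>i. u i k) summable_on UNIV" by (rule abs_summable_summable[OF ua])
    have sm2: "(\<lambda>i. u i k) summable_on range Suc" by (rule summable_on_subset[OF sm]) auto
    \<comment> \<open>Splitting off \<open>i = 0\<close> leaves the shifted series, which is minus
      \<open>R\<close> applied to \<open>w\<close>.\<close>
    have "w k = (\<Sum>\<^sub>\<infinity>i\<in>insert 0 (range Suc). u i k)"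
      unfolding w_def by (simp only: UNIV_nat_eq[symmetric])
    also have "\<dots> = u 0 k + (\<Sum>\<^sub>\<infinity>i\<in>range Suc. u i k)"
      by (rule infsum_insert[OF sm2]) auto
    also have "(\<Sum>\<^sub>\<infinity>i\<in>range Suc. u i k) = (\<Sum>\<^sub>\<infinity>i. u (Suc i) k)"
      by (subst infsum_reindex) (auto simp: o_def)
    finally show ?thesis using 1 by (simp add: u0)
  qed
  with w1 op(1)[OF w1] that show ?thesis by blast
qed

section \<open>Series of kernels\<close>

text \<open>The real part is positive, so the principal power is holomorphic at this value.\<close>

lemma one_minus_herm_notin_nonpos_Reals:
  assumes "norm z < 1" "norm a < 1"
  shows "1 - herm z a \<notin> \<real>\<^sub>\<le>\<^sub>0"
proof -
  have "norm z * norm a < 1" using assms mult_le_one[of "norm z" "norm a"]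
    by (smt (verit) mult_left_le norm_ge_zero)
  then have "Re (herm z a) < 1" using complex_Re_le_cmod[of "herm z a"] cmod_herm_le[of z a] by linarith
  then show ?thesis by (auto simp: complex_nonpos_Reals_iff)
qed

lemma has_derivative_herm_powr:
  fixes p :: complex
  assumes "norm z < 1" "norm a < 1"
  shows "((\<lambda>z. (1 - herm z a) powr p) has_derivative
     (\<lambda>h. - herm h a * (p * (1 - herm z a) powr (p - 1)))) (at z within S)"
proof -
  have "((\<lambda>w. w powr p) has_derivative (*) (p * (1 - herm z a) powr (p - 1))) (at (1 - herm z a))"
    using has_field_derivative_powr[OF one_minus_herm_notin_nonpos_Reals[OF assms]]
    unfolding has_field_derivative_def .
  moreover have "((\<lambda>z. 1 - herm z a) has_derivative (\<lambda>h. - herm h a)) (at z within S)"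
    by (auto intro!: derivative_eq_intros bounded_linear_imp_has_derivative bounded_linear_herm)
  ultimately show ?thesis by (subst mult.commute) (rule has_derivative_compose[rotated])
qed

text \<open>Termwise differentiation on a ball of radius \<open>r < 1\<close>, where the derivatives
  have a summable majorant. Complex linearity of the termwise derivatives passes to their
  sum.\<close>

lemma holo_on_kernel_series:
  fixes a :: "nat \<Rightarrow> complex^'n" and d :: "nat \<Rightarrow> complex" and s :: real
  assumes a: "\<And>j. norm (a j) < 1" and d: "summable (\<lambda>j. cmod (d j))" and s: "s \<ge> 0"
  shows "\<And>z. norm z < 1 \<Longrightarrow> summable (\<lambda>j. cmod (d j * (1 - herm z (a j)) powr - of_real s))"
    and "holo_on (\<lambda>z. \<Sum>j. d j * (1 - herm z (a j)) powr - of_real s) unit_ball"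
proof -
  define k where "k = (\<lambda>j z. d j * (1 - herm z (a j)) powr - of_real s)"
  \<comment> \<open>The points \<open>a j\<close> may approach the sphere, but
    \<open>cmod (1 - herm z (a j)) \<ge> 1 - norm z\<close> makes the bound independent of
    \<open>j\<close>. For a real exponent the modulus of the power is the power of the
    modulus.\<close>
  have pb: "cmod ((1 - herm z (a j)) powr - of_real p) \<le> (1 - r) powr - p"
    if "norm z \<le> r" "r < 1" "p \<ge> 0" for z j p r
  proof -
    have "1 - r \<le> cmod (1 - herm z (a j))"
      using one_minus_norm_left_le_cmod[of "a j" z] a[of j] that by simp
    then have "cmod (1 - herm z (a j)) powr - p \<le> (1 - r) powr - p"
      using that by (intro powr_mono2') auto
    then show ?thesis by (subst norm_powr_real_powr') auto
  qed
  show sm: "summable (\<lambda>j. cmod (d j * (1 - herm z (a j)) powr - of_real s))" if z: "norm z < 1" for z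
  proof (rule summable_comparison_test'[where N=0])
    show "summable (\<lambda>j. cmod (d j) * (1 - norm z) powr - s)" by (intro summable_mult2 d)
    show "norm (cmod (d j * (1 - herm z (a j)) powr - of_real s)) \<le> cmod (d j) * (1 - norm z) powr - s" for j
      using pb[of z "norm z" s j] z s by (simp add: norm_mult mult_left_mono)
  qed
  show "holo_on (\<lambda>z. \<Sum>j. d j * (1 - herm z (a j)) powr - of_real s) unit_ball"
    unfolding holo_on_def
  proof
    fix z0 :: "complex^'n" assume "z0 \<in> unit_ball"
    then have z0: "norm z0 < 1" by (simp add: unit_ball_def)
    define r where "r = (1 + norm z0) / 2"
    have r: "norm z0 < r" "r < 1" using z0 by (auto simp: r_def)
    define D where "D = (\<lambda>j z h. d j * (- herm h (a j) * (- of_real s * (1 - herm z (a j)) powr (- of_real s - 1))))"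
    \<comment> \<open>Majorant for the operator norms of \<open>D j z\<close> on the ball of radius
      \<open>r\<close>; its tails give the uniform convergence below.\<close>
    define M where "M = (\<lambda>j. cmod (d j) * (s * (1 - r) powr - (s + 1)))"
    have M: "summable M" unfolding M_def by (intro summable_mult2 d)
    have kD: "(k j has_derivative D j z) (at z within T)" if "norm z < 1" for j z T
      unfolding k_def D_def
      by (intro has_derivative_mult_right has_derivative_herm_powr that a)
    have Db: "cmod (D j z h) \<le> M j * norm h" if "norm z < r" for j z h
    proof -
      have "cmod (herm h (a j)) \<le> norm h"
        using cmod_herm_le[of h "a j"] a[of j] mult_left_le[of "norm (a j)" "norm h"] by simp
      moreover have "cmod ((1 - herm z (a j)) powr (- of_real s - 1)) \<le> (1 - r) powr - (s + 1)"
      proof -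
        have "- complex_of_real s - 1 = - of_real (s + 1)" by simp
        then show ?thesis using pb[of z r "s + 1" j] that r s by (simp only:)
      qed
      ultimately have "cmod (d j) * (cmod (herm h (a j)) * (s * cmod ((1 - herm z (a j)) powr (- of_real s - 1))))
         \<le> cmod (d j) * (norm h * (s * (1 - r) powr - (s + 1)))"
        using s by (intro mult_left_mono mult_mono) auto
      then show ?thesis using s by (simp add: D_def M_def norm_mult mult_ac)
    qed
    have Dsm: "summable (\<lambda>j. norm (D j z h))" if "norm z < r" for z h
      by (rule summable_comparison_test'[where N=0, OF summable_mult2[OF M, of "norm h"]]) (use Db[OF that] in auto)
    have "\<exists>g. \<forall>x\<in>ball 0 r. (\<lambda>j. k j x) sums (g x) \<and> (g has_derivative (\<lambda>h. \<Sum>j. D j x h)) (at x within ball 0 r)"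
    proof (rule has_derivative_series)
      show "convex (ball (0::complex^'n) r)" by (rule convex_ball)
      show "(k j has_derivative D j x) (at x within ball 0 r)" if "x \<in> ball 0 r" for j x
        using that r by (intro kD) auto
      show "z0 \<in> ball 0 r" using r by simp
      show "(\<lambda>j. k j z0) sums (\<Sum>j. k j z0)"
        using sm[OF z0] unfolding k_def by (rule summable_sums[OF summable_norm_cancel])
      fix e :: real assume e: "e > 0"
      obtain n0 where n0: "\<And>n. n \<ge> n0 \<Longrightarrow> norm (\<Sum>i. M (i + n)) < e"
        using suminf_exist_split[OF e M] by blast
      show "\<forall>\<^sub>F n in sequentially. \<forall>x\<in>ball 0 r. \<forall>h. norm ((\<Sum>i<n. D i x h) - (\<Sum>j. D j x h)) \<le> e * norm h"
      proof (rule eventually_sequentiallyI[of n0], intro ballI allI)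
        fix n and x h :: "complex^'n" assume n: "n \<ge> n0" and x: "x \<in> ball 0 r"
        have x': "norm x < r" using x by simp
        have Ms: "summable (\<lambda>i. M (i + n) * norm h)" by (intro summable_mult2 summable_ignore_initial_segment M)
        have Ds: "summable (\<lambda>i. norm (D (i + n) x h))"
          using summable_ignore_initial_segment[OF Dsm[OF x', of h], of n] by simp
        have "norm ((\<Sum>i<n. D i x h) - (\<Sum>j. D j x h)) = norm (\<Sum>i. D (i + n) x h)"
          using suminf_minus_initial_segment[OF summable_norm_cancel[OF Dsm[OF x', of h]], of n]
          by (simp add: norm_minus_commute)
        also have "\<dots> \<le> (\<Sum>i. norm (D (i + n) x h))" by (rule summable_norm[OF Ds])
        also have "\<dots> \<le> (\<Sum>i. M (i + n) * norm h)" by (intro suminf_le Db x' Ds Ms)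
        also have "\<dots> = (\<Sum>i. M (i + n)) * norm h"
          by (rule suminf_mult2[symmetric]) (intro summable_ignore_initial_segment M)
        also have "\<dots> \<le> e * norm h" using n0[OF n] by (intro mult_right_mono) auto
        finally show "norm ((\<Sum>i<n. D i x h) - (\<Sum>j. D j x h)) \<le> e * norm h" .
      qed
    qed
    then obtain g where g: "\<And>x. x \<in> ball 0 r \<Longrightarrow> (\<lambda>j. k j x) sums (g x)"
      "\<And>x. x \<in> ball 0 r \<Longrightarrow> (g has_derivative (\<lambda>h. \<Sum>j. D j x h)) (at x within ball 0 r)" by blast
    have z0r: "z0 \<in> ball 0 r" using r by simp
    have "(g has_derivative (\<lambda>h. \<Sum>j. D j z0 h)) (at z0)"
      using g(2)[OF z0r] at_within_open[OF z0r open_ball] by simp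
    then have "((\<lambda>z. \<Sum>j. k j z) has_derivative (\<lambda>h. \<Sum>j. D j z0 h)) (at z0)"
      by (rule has_derivative_transform_within_open[OF _ open_ball z0r]) (use g(1) sums_unique in blast)
    moreover have "(\<Sum>j. D j z0 (c *s h)) = c * (\<Sum>j. D j z0 h)" for c h
    proof -
      have "D j z0 (c *s h) = c * D j z0 h" for j by (simp add: D_def herm_scale)
      then show ?thesis using suminf_mult[OF summable_norm_cancel[OF Dsm[OF r(1), of h]], of c] by simp
    qed
    ultimately show "\<exists>D. ((\<lambda>z. \<Sum>j. d j * (1 - herm z (a j)) powr - of_real s) has_derivative D) (at z0)
       \<and> (\<forall>c w. D (c *s w) = c * D w)"
      unfolding k_def by blast
  qed
qed

section \<open>Construction of the interpolating function\<close>

theorem theorem4p2: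
  fixes a :: "nat \<Rightarrow> complex^'n" and \<alpha> :: real
  assumes "\<alpha> > -1"
    and "\<forall>k. a k \<in> unit_ball"
    and "separated a"
    and "\<exists>m>0. Kconst a m (real CARD('n) + 1 + \<alpha>) < 1"
  shows "interpolating_B1 \<alpha> a"
  unfolding interpolating_B1_def
proof (intro allI impI)
  fix v :: "nat \<Rightarrow> complex"
  define N where "N = real CARD('n) + 1 + \<alpha>"
  define A where "A = (\<lambda>k. 1 - (norm (a k))\<^sup>2)"
  define W where "W = (\<lambda>k. A k powr N)"
  assume "summable (\<lambda>k. (1 - (norm (a k))\<^sup>2) powr (real CARD('n) + 1 + \<alpha>) * cmod (v k))"
  then have v: "(\<lambda>k. W k * cmod (v k)) summable_on UNIV"
    by (subst summable_on_UNIV_nonneg_real_iff) (auto simp: W_def A_def N_def)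
  obtain m where m: "m > 0" "Kconst a m N < 1" using assms(4) by (auto simp: N_def)
  have N: "N > 0" using assms(1) by (simp add: N_def add_pos_pos)
  define s where "s = m + N"
  have s: "s > 0" using m N by (simp add: s_def)
  have a1: "norm (a k) < 1" for k using assms(2) by (simp add: unit_ball_def)
  have A: "A k > 0" "A k \<le> 1" for k using a1[of k] by (auto simp: A_def abs_square_less_1)
  have W: "W k > 0" for k using A[of k] by (simp add: W_def)
  define ker where "ker = (\<lambda>j z. of_real (A j powr s) * (1 - herm z (a j)) powr - complex_of_real s)"
  have ker_norm: "cmod (ker j z) = A j powr s * cmod (1 - herm z (a j)) powr - s" for j z
    by (simp add: ker_def norm_mult norm_powr_real_powr')
  have ker_self: "ker j (a j) = 1" for j
  proof -
    have "1 - herm (a j) (a j) = of_real (A j)" by (simp add: herm_self A_def)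
    then have "(1 - herm (a j) (a j)) powr - complex_of_real s = of_real (A j powr - s)"
      using powr_of_real[of "A j" "- s"] A[of j] by simp
    then show ?thesis using A(1)[of j] by (simp add: ker_def flip: of_real_mult powr_add)
  qed
  \<comment> \<open>The off-diagonal part of the interpolation matrix. As \<open>ker_self\<close>
    makes the diagonal 1, the interpolation problem reads \<open>(I + R) w = v\<close>.\<close>
  define R where "R = (\<lambda>k j. if k = j then 0 else ker j (a k))"
  obtain \<kappa> where \<kappa>: "0 \<le> \<kappa>" "Kconst a m N = ennreal \<kappa>"
    using m(2) by (cases "Kconst a m N" rule: ennreal_cases) auto
  have \<kappa>1: "\<kappa> < 1" using m(2) \<kappa> by (simp add: ennreal_less_one_iff)
  \<comment> \<open>Dividing the weighted column entry by \<open>W j = A j powr N\<close> turns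
    \<open>A j powr s\<close> into \<open>A j powr m\<close>. What remains is the summand of
    \<open>Kconst a m N\<close> with \<open>j\<close> as the fixed index, so the column sums are at
    most \<open>\<kappa> * W j\<close>.\<close>
  define t where "t = (\<lambda>j k. if k = j then 0 else A j powr m * A k powr N / cmod (1 - herm (a k) (a j)) powr s)"
  have t0: "t j k \<ge> 0" for j k by (simp add: t_def)
  have tR: "W k * cmod (R k j) = W j * t j k" for k j
  proof -
    have "A j powr s = A j powr m * A j powr N" by (simp add: s_def powr_add)
    then show ?thesis by (simp add: R_def t_def ker_norm W_def powr_minus_divide)
  qed
  have tsum: "(\<Sum>k. ennreal (t j k)) \<le> ennreal \<kappa>" for j
  proof -
    have "(\<Sum>k. ennreal (t j k)) = (\<Sum>k. if k = j then 0 else ennreal (A j powr m * A k powr N / cmod (1 - herm (a k) (a j)) powr (m + N)))"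
      by (intro suminf_cong) (simp add: t_def s_def)
    also have "\<dots> \<le> Kconst a m N" unfolding Kconst_def A_def by (rule SUP_upper) simp
    finally show ?thesis by (simp add: \<kappa>)
  qed
  have ts: "summable (t j)" for j
    using tsum[of j] t0 by (intro summable_suminf_not_top) (auto simp: top_unique)
  have tle: "suminf (t j) \<le> \<kappa>" for j
    using tsum[of j] t0 ts[of j] \<kappa>(1) by (simp add: suminf_ennreal2 suminf_nonneg)
  have ths: "(t j has_sum suminf (t j)) UNIV" for j
    using ts[of j] t0 by (intro norm_summable_imp_has_sum summable_sums) auto
  have col: "((\<lambda>k. W k * cmod (R k j)) has_sum (W j * suminf (t j))) UNIV" for j
    unfolding tR by (intro has_sum_cmult_right ths)
  obtain w where w: "(\<lambda>j. W j * cmod (w j)) summable_on UNIV"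
    "\<And>k. (\<lambda>j. norm (R k j * w j)) summable_on UNIV"
    "\<And>k. w k + (\<Sum>\<^sub>\<infinity>j. R k j * w j) = v k"
  proof (rule weighted_l1_neumann[OF W _ _ \<kappa>(1) \<kappa>1 v, of R])
    show "(\<lambda>k. W k * cmod (R k j)) summable_on UNIV" for j using col summable_on_def by blast
    show "(\<Sum>\<^sub>\<infinity>k. W k * cmod (R k j)) \<le> \<kappa> * W j" for j
      using infsumI[OF col[of j]] tle[of j] W[of j] by (simp add: mult.commute)
  qed blast
  have ws: "summable (\<lambda>j. W j * cmod (w j))" using w(1) by (rule summable_on_imp_summable)
  define d where "d = (\<lambda>j. w j * of_real (A j powr s))"
  have ds: "summable (\<lambda>j. cmod (d j))"
  proof (rule summable_comparison_test'[where N=0, OF ws])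
    fix j
    \<comment> \<open>Here \<open>0 < A j \<le> 1\<close> and \<open>s > N\<close>, so the factor in
      the kernel is at most the weight.\<close>
    have "A j powr s \<le> A j powr N" using A[of j] m by (intro powr_mono') (auto simp: s_def)
    then show "norm (cmod (d j)) \<le> W j * cmod (w j)"
      by (simp add: d_def norm_mult W_def mult_left_mono mult.commute)
  qed
  define f where "f = (\<lambda>z. \<Sum>j. d j * (1 - herm z (a j)) powr - complex_of_real s)"
  have f: "f z = (\<Sum>j. w j * ker j z)" for z by (simp add: f_def d_def ker_def mult_ac)
  have fs: "summable (\<lambda>j. cmod (w j * ker j z))" if "norm z < 1" for z
    using holo_on_kernel_series(1)[of a d s z] a1 ds s that by (simp add: d_def ker_def mult_ac)
  have "holo_on f unit_ball"
    unfolding f_def using holo_on_kernel_series(2)[of a d s] a1 ds s by simp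
  moreover have "(\<integral>\<^sup>+ z. ennreal (indicator unit_ball z * (1 - (norm z)\<^sup>2) powr \<alpha> * cmod (f z)) \<partial>lborel) < \<infinity>"
  proof -
    obtain C where C: "C \<ge> 0"
      "\<And>a::complex^'n. norm a < 1 \<Longrightarrow>
        (\<integral>\<^sup>+ z. ennreal (indicator unit_ball z * (1 - (norm z)\<^sup>2) powr \<alpha> * cmod (1 - herm z a) powr - s) \<partial>lborel)
        \<le> ennreal (C * (1 - (norm a)\<^sup>2) powr - m)"
      unfolding s_def N_def using forelli_rudin_estimate[OF assms(1) m(1), where 'n='n] by blast
    define g where "g = (\<lambda>j (z::complex^'n). indicator unit_ball z * (1 - (norm z)\<^sup>2) powr \<alpha> * cmod (1 - herm z (a j)) powr - s)"
    have [measurable]: "(unit_ball :: (complex^'n) set) \<in> sets borel" by (simp add: unit_ball_def)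
    have g_meas [measurable]: "g j \<in> borel_measurable borel" for j unfolding g_def by measurable
    have g0: "g j z \<ge> 0" for j z by (simp add: g_def)
    have "(\<integral>\<^sup>+ z. ennreal (indicator unit_ball z * (1 - (norm z)\<^sup>2) powr \<alpha> * cmod (f z)) \<partial>lborel)
      \<le> (\<integral>\<^sup>+ z. (\<Sum>j. ennreal (cmod (w j) * A j powr s) * ennreal (g j z)) \<partial>lborel)"
    proof (intro nn_integral_mono)
      fix z :: "complex^'n"
      show "ennreal (indicator unit_ball z * (1 - (norm z)\<^sup>2) powr \<alpha> * cmod (f z))
        \<le> (\<Sum>j. ennreal (cmod (w j) * A j powr s) * ennreal (g j z))"
      proof (cases "norm z < 1")
        case True
        define \<beta> where "\<beta> = (1 - (norm z)\<^sup>2) powr \<alpha>"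
        have "\<beta> * cmod (f z) \<le> \<beta> * (\<Sum>j. cmod (w j * ker j z))"
          unfolding f by (intro mult_left_mono summable_norm fs True) (simp add: \<beta>_def)
        also have "\<dots> = (\<Sum>j. \<beta> * cmod (w j * ker j z))" by (rule suminf_mult[symmetric, OF fs[OF True]])
        finally have "ennreal (\<beta> * cmod (f z)) \<le> ennreal (\<Sum>j. \<beta> * cmod (w j * ker j z))" by (rule ennreal_leI)
        also have "\<dots> = (\<Sum>j. ennreal (\<beta> * cmod (w j * ker j z)))"
          by (rule suminf_ennreal2[symmetric]) (auto simp: \<beta>_def intro!: summable_mult fs True)
        also have "\<dots> = (\<Sum>j. ennreal (cmod (w j) * A j powr s) * ennreal (g j z))"
          using True by (intro suminf_cong) (simp add: g_def ker_norm norm_mult \<beta>_def unit_ball_def mult_ac flip: ennreal_mult)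
        finally show ?thesis using True by (simp add: \<beta>_def unit_ball_def)
      qed (simp add: unit_ball_def)
    qed
    also have "\<dots> = (\<Sum>j. \<integral>\<^sup>+ z. ennreal (cmod (w j) * A j powr s) * ennreal (g j z) \<partial>lborel)"
      by (rule nn_integral_suminf) measurable
    also have "\<dots> = (\<Sum>j. ennreal (cmod (w j) * A j powr s) * (\<integral>\<^sup>+ z. ennreal (g j z) \<partial>lborel))"
      by (intro suminf_cong nn_integral_cmult) measurable
    also have "\<dots> \<le> (\<Sum>j. ennreal (cmod (w j) * A j powr s) * ennreal (C * A j powr - m))"
      unfolding g_def A_def by (intro suminf_le summableI mult_left_mono C(2) a1) auto
    also have "\<dots> = (\<Sum>j. ennreal (C * (W j * cmod (w j))))"
    proof (intro suminf_cong)
      fix j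
      \<comment> \<open>The loss \<open>A j powr - m\<close> in the kernel integral leaves exactly
        the weight \<open>W j\<close>, so the norm of \<open>f\<close> is controlled by the weighted
        norm of \<open>w\<close>.\<close>
      have "A j powr s * A j powr - m = W j" by (simp add: s_def W_def flip: powr_add)
      then have eq: "cmod (w j) * A j powr s * (C * A j powr - m) = C * (W j * cmod (w j))" by (simp add: mult_ac)
      show "ennreal (cmod (w j) * A j powr s) * ennreal (C * A j powr - m) = ennreal (C * (W j * cmod (w j)))"
        using C(1) by (simp only: eq ennreal_mult[symmetric] powr_ge_zero norm_ge_zero mult_nonneg_nonneg)
    qed
    also have "\<dots> = ennreal (\<Sum>j. C * (W j * cmod (w j)))"
      by (rule suminf_ennreal2) (use C(1) W in \<open>auto intro!: summable_mult ws mult_nonneg_nonneg less_imp_le[OF W]\<close>)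
    also have "\<dots> < \<infinity>" by simp
    finally show ?thesis .
  qed
  moreover have "f (a k) = v k" for k
  proof -
    have "(\<lambda>j. R k j * w j) sums (\<Sum>\<^sub>\<infinity>j. R k j * w j)"
      by (rule has_sum_imp_sums[OF has_sum_infsum[OF abs_summable_summable[OF w(2)]]])
    \<comment> \<open>The single term restores the diagonal that \<open>R\<close> omits, turning the
      series of \<open>R k j * w j\<close> into the one for \<open>f (a k)\<close>.\<close>
    from sums_add[OF sums_single[of k w] this]
    have "(\<lambda>j. w j * ker j (a k)) sums (w k + (\<Sum>\<^sub>\<infinity>j. R k j * w j))"
      by (rule sums_cong[THEN iffD1, rotated]) (auto simp: R_def ker_self)
    then show ?thesis unfolding f w(3) by (rule sums_unique[symmetric])
  qed
  ultimately show "\<exists>f\<in>bergman1 \<alpha>. \<forall>k. f (a k) = v k" unfolding bergman1_def by blast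
qed

end
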